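(* Let $\mathcal{X}$ be an Artin spherical group with classical generators $x_1,\dots,x_n$, and let $\Delta$ be its Garside element. Consider $\mathcal{X}$ as a monoid generated by $\{x_1,\dots,x_n,\nabla\}$ where $\nabla=\Delta^{-1}$, and let $g_k$ be the number of elements of $\mathcal{X}$ whose word length with respect to this monoid generating set equals $k$. Then $(g_k)$ has growth rate less than $4$, i.e. $\limsup_k g_k^{1/k}<4$.
   Context: An Artin spherical group is the group given by the presentation $\langle x_1,\dots,x_n\mid x_ix_jx_i\cdots=x_jx_ix_j\cdots$ (both sides of length $r_{ij}$, for $r_{ij}<\infty$)$\rangle$ where the labels $r_{ij}$ come from a finite Coxeter graph whose connected components are of type $A_n$ ($n\ge1$), $B_n$ ($n\ge2$), $D_n$ ($n\ge4$), $E_6,E_7,E_8$, $F_4$, $G_2$, $H_3$, $H_4$, or $I_2(p)$ ($p\ge5,p\ne6$) (the finite Coxeter groups' diagrams; $r_{ij}=2$ if no edge, $3$ for an unlabeled edge). The Garside element $\Delta$ is the least common (left) multiple of $x_1,\dots,x_n$ in the associated positive monoid $\mathcal{X}^+$ (the monoid with the same presentation). A sequence $(s_k)$ of positive numbers has growth rate less than $\gamma$ if $\limsup_k \exp(\log(s_k)/k)<\gamma$. *)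

theory Defs
  imports Complex_Main "HOL-Library.Extended_Real" "HOL-Library.Liminf_Limsup"
begin

text \<open>A Coxeter diagram on vertices 0..k-1 is given by a list of labelled edges (i, j, m);
  non-listed pairs carry label 2.\<close>

definition diag_lab :: "(nat \<times> nat \<times> nat) list \<Rightarrow> nat \<Rightarrow> nat \<Rightarrow> nat" where
  "diag_lab es i j =
     (case find (\<lambda>(a, b, m). {a, b} = {i, j}) es of Some (_, _, m) \<Rightarrow> m | None \<Rightarrow> 2)"

definition chain_edges :: "nat \<Rightarrow> nat \<Rightarrow> (nat \<times> nat \<times> nat) list" where
  "chain_edges a b = map (\<lambda>i. (i, Suc i, 3)) [a..<b]"

definition diag_A :: "nat \<Rightarrow> (nat \<times> nat \<times> nat) list" where
  "diag_A k = chain_edges 0 (k - 1)"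
definition diag_B :: "nat \<Rightarrow> (nat \<times> nat \<times> nat) list" where
  "diag_B k = (0, 1, 4) # chain_edges 1 (k - 1)"
definition diag_D :: "nat \<Rightarrow> (nat \<times> nat \<times> nat) list" where
  "diag_D k = (k - 3, k - 1, 3) # chain_edges 0 (k - 2)"
definition diag_E :: "nat \<Rightarrow> (nat \<times> nat \<times> nat) list" where
  "diag_E k = (2, k - 1, 3) # chain_edges 0 (k - 2)"
definition diag_F4 :: "(nat \<times> nat \<times> nat) list" where
  "diag_F4 = [(0, 1, 3), (1, 2, 4), (2, 3, 3)]"
definition diag_H :: "nat \<Rightarrow> (nat \<times> nat \<times> nat) list" where
  "diag_H k = (0, 1, 5) # chain_edges 1 (k - 1)"
definition diag_I2 :: "nat \<Rightarrow> (nat \<times> nat \<times> nat) list" where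
  "diag_I2 p = [(0, 1, p)]"

text \<open>Connected Coxeter diagrams of finite type with k vertices:
  A_k (k>=1), B_k (k>=2), D_k (k>=4), E_6, E_7, E_8, F_4, G_2 (= I_2(6)), H_3, H_4,
  I_2(p) (p>=5, p~=6).\<close>
definition std_diag :: "nat \<Rightarrow> (nat \<times> nat \<times> nat) list \<Rightarrow> bool" where
  "std_diag k es \<longleftrightarrow>
     (k \<ge> 1 \<and> es = diag_A k) \<or> (k \<ge> 2 \<and> es = diag_B k) \<or> (k \<ge> 4 \<and> es = diag_D k) \<or>
     (k \<in> {6, 7, 8} \<and> es = diag_E k) \<or> (k = 4 \<and> es = diag_F4) \<or>
     (k = 2 \<and> es = diag_I2 6) \<or> (k \<in> {3, 4} \<and> es = diag_H k) \<or>
     (\<exists>p. k = 2 \<and> p \<ge> 5 \<and> p \<noteq> 6 \<and> es = diag_I2 p)"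

text \<open>A Coxeter matrix M on the generators 0..n-1 (off-diagonal entries used) is spherical
  if its vertex set splits into blocks (the connected components), with label 2 between
  different blocks, each block being isomorphic to one of the standard diagrams.\<close>
definition spherical :: "nat \<Rightarrow> (nat \<Rightarrow> nat \<Rightarrow> nat) \<Rightarrow> bool" where
  "spherical n M \<longleftrightarrow>
     (\<exists>P. \<Union>P = {..<n} \<and> (\<forall>C\<in>P. C \<noteq> {}) \<and>
          (\<forall>C\<in>P. \<forall>D\<in>P. C \<noteq> D \<longrightarrow> C \<inter> D = {}) \<and>
          (\<forall>C\<in>P. \<forall>D\<in>P. C \<noteq> D \<longrightarrow> (\<forall>i\<in>C. \<forall>j\<in>D. M i j = 2)) \<and>
          (\<forall>C\<in>P. \<exists>f es. bij_betw f C {..<card C} \<and> std_diag (card C) es \<and>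
                     (\<forall>i\<in>C. \<forall>j\<in>C. i \<noteq> j \<longrightarrow> M i j = diag_lab es (f i) (f j))))"

definition alt :: "nat \<Rightarrow> nat \<Rightarrow> nat \<Rightarrow> nat list" where
  "alt i j m = map (\<lambda>k. if even k then i else j) [0..<m]"

inductive peq :: "nat \<Rightarrow> (nat \<Rightarrow> nat \<Rightarrow> nat) \<Rightarrow> nat list \<Rightarrow> nat list \<Rightarrow> bool"
  for n M where
  prefl: "peq n M u u"
| psym: "peq n M u v \<Longrightarrow> peq n M v u"
| ptrans: "peq n M u v \<Longrightarrow> peq n M v w \<Longrightarrow> peq n M u w"
| prel: "i < n \<Longrightarrow> j < n \<Longrightarrow> i \<noteq> j \<Longrightarrow>
         peq n M (u @ alt i j (M i j) @ v) (u @ alt j i (M i j) @ v)"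

text \<open>Group words: letters (i, True) = x_i, (i, False) = x_i^{-1}. Congruence of the Artin group.\<close>
inductive geq :: "nat \<Rightarrow> (nat \<Rightarrow> nat \<Rightarrow> nat) \<Rightarrow> (nat \<times> bool) list \<Rightarrow> (nat \<times> bool) list \<Rightarrow> bool"
  for n M where
  grefl: "geq n M u u"
| gsym: "geq n M u v \<Longrightarrow> geq n M v u"
| gtrans: "geq n M u v \<Longrightarrow> geq n M v w \<Longrightarrow> geq n M u w"
| gcancel: "i < n \<Longrightarrow> geq n M (u @ [(i, b), (i, \<not> b)] @ v) (u @ v)"
| grel: "i < n \<Longrightarrow> j < n \<Longrightarrow> i \<noteq> j \<Longrightarrow>
         geq n M (u @ map (\<lambda>a. (a, True)) (alt i j (M i j)) @ v)
                 (u @ map (\<lambda>a. (a, True)) (alt j i (M i j)) @ v)"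

definition gclass :: "nat \<Rightarrow> (nat \<Rightarrow> nat \<Rightarrow> nat) \<Rightarrow> (nat \<times> bool) list \<Rightarrow> (nat \<times> bool) list set" where
  "gclass n M w = {v. geq n M w v}"

definition pos_word :: "nat \<Rightarrow> nat list \<Rightarrow> bool" where
  "pos_word n w \<longleftrightarrow> set w \<subseteq> {..<n}"

definition common_left_mult :: "nat \<Rightarrow> (nat \<Rightarrow> nat \<Rightarrow> nat) \<Rightarrow> nat list \<Rightarrow> bool" where
  "common_left_mult n M W \<longleftrightarrow> pos_word n W \<and>
     (\<forall>i<n. \<exists>u. pos_word n u \<and> peq n M (u @ [i]) W)"

definition is_garside :: "nat \<Rightarrow> (nat \<Rightarrow> nat \<Rightarrow> nat) \<Rightarrow> nat list \<Rightarrow> bool" where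
  "is_garside n M D \<longleftrightarrow> common_left_mult n M D \<and>
     (\<forall>W. common_left_mult n M W \<longrightarrow> (\<exists>v. pos_word n v \<and> peq n M (v @ D) W))"

definition garside :: "nat \<Rightarrow> (nat \<Rightarrow> nat \<Rightarrow> nat) \<Rightarrow> nat list" where
  "garside n M = (SOME D. is_garside n M D)"

text \<open>Monoid alphabet: Some i = x_i, None = nabla = Delta^{-1}.\<close>
definition nabla_word :: "nat \<Rightarrow> (nat \<Rightarrow> nat \<Rightarrow> nat) \<Rightarrow> (nat \<times> bool) list" where
  "nabla_word n M = rev (map (\<lambda>a. (a, False)) (garside n M))"

definition eval_word :: "nat \<Rightarrow> (nat \<Rightarrow> nat \<Rightarrow> nat) \<Rightarrow> nat option list \<Rightarrow> (nat \<times> bool) list" where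
  "eval_word n M w =
     concat (map (\<lambda>a. case a of Some i \<Rightarrow> [(i, True)] | None \<Rightarrow> nabla_word n M) w)"

definition valid_mword :: "nat \<Rightarrow> nat option list \<Rightarrow> bool" where
  "valid_mword n w \<longleftrightarrow> (\<forall>a\<in>set w. a = None \<or> (\<exists>i<n. a = Some i))"

definition sphere_count :: "nat \<Rightarrow> (nat \<Rightarrow> nat \<Rightarrow> nat) \<Rightarrow> nat \<Rightarrow> nat" where
  "sphere_count n M k = card {c.
     (\<exists>w. valid_mword n w \<and> length w = k \<and> c = gclass n M (eval_word n M w)) \<and>
     \<not> (\<exists>w. valid_mword n w \<and> length w < k \<and> c = gclass n M (eval_word n M w))}"

end

theory Submission
  imports Defs "HOL-Library.Monad_Syntax"
begin

text \<open>
  The Garside element satisfies \<open>\<Delta> x\<^sub>j = x\<^sub>j\<^sub>' \<Delta>\<close>, so every word in the generators and \<open>\<nabla>\<close> equals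
  \<open>\<nabla> ^ r * p\<close> with \<open>p\<close> positive, and \<open>g\<^sub>k\<close> is at most the number of elements of length at most \<open>k\<close> of
  the positive monoid.

  That monoid is bounded using only its commutation relations. When a letter \<open>c\<close> that commutes with
  the letters of \<open>Q \<subseteq> S\<close> is adjoined to the alphabet \<open>S\<close>, every word factors as \<open>x\<^sub>1 c \<dots> x\<^sub>m c y\<close> with \<open>y\<close>
  a word over \<open>S\<close> and the \<open>x\<^sub>i\<close> among the representatives of \<open>S\<close> modulo \<open>Q\<close>. If the growth series of
  these has the value \<open>b\<close> at \<open>\<tau>\<close>, that of the words \<open>x\<^sub>1 c \<dots> x\<^sub>m c\<close> has a value of at most
  \<open>1 / (1 - \<tau> b)\<close>. At \<open>\<tau> = 1/4\<close> this map has the fixed point 2. The components of the diagram are trees of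
  type \<open>A\<close>, \<open>D\<close> or \<open>E\<close> up to labels, and when such a tree is built up towards the end of its longest
  arm, the values never exceed 2; the branching vertex of type \<open>E\<close> meets the bound with equality. So
  the growth series is still finite slightly beyond \<open>1/4\<close>.

  That \<open>\<Delta>\<close> exists at all requires least common multiples in the positive monoid. They are obtained as by
  Garside and by Brieskorn and Saito, the three-generator case being the computation of word reversings
  in types \<open>A\<^sub>3\<close>, \<open>B\<^sub>3\<close>, \<open>H\<^sub>3\<close>. A common multiple of all generators is built inductively in the classical
  types, and in the exceptional types it is checked that a suitable power of a Coxeter element is one.
\<close>

section \<open>Words modulo the braid relations\<close>

lemma alt_0 [simp]: "alt i j 0 = []"
  by (simp add: alt_def)

lemma alt_Suc [simp]: "alt i j (Suc m) = i # alt j i m"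
proof -
  have "[0..<Suc m] = 0 # map Suc [0..<m]"
    by (simp only: upt_conv_Cons map_Suc_upt)
  then show ?thesis by (auto simp: alt_def)
qed

lemma alt_snoc: "alt i j (Suc m) = alt i j m @ [if even m then i else j]"
  by (simp add: alt_def)

lemma length_alt [simp]: "length (alt i j m) = m"
  by (simp add: alt_def)

lemma set_alt: "set (alt i j m) \<subseteq> {i, j}"
  by (auto simp: alt_def)

lemma map_alt: "map g (alt i j m) = alt (g i) (g j) m"
  by (simp add: alt_def)

lemma rev_alt: "rev (alt i j m) = (if even m then alt j i m else alt i j m)"
proof (induction m arbitrary: i j)
  case (Suc m)
  have "rev (alt i j (Suc m)) = rev (alt j i m) @ [i]" by simp
  also have "\<dots> = (if even m then alt i j m else alt j i m) @ [i]" by (simp add: Suc)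
  also have "\<dots> = (if even (Suc m) then alt j i (Suc m) else alt i j (Suc m))"
    by (simp only: alt_snoc) auto
  finally show ?case .
qed simp

declare peq.prefl [simp, intro] and peq.ptrans [trans]

locale artin_monoid =
  fixes n :: nat and M :: "nat \<Rightarrow> nat \<Rightarrow> nat"
begin

abbreviation eqv :: "nat list \<Rightarrow> nat list \<Rightarrow> bool" (infix "\<approx>" 50) where
  "u \<approx> v \<equiv> peq n M u v"

lemma peq_context:
  assumes "u \<approx> v"
  shows "x @ u @ y \<approx> x @ v @ y"
  using assms
proof induction
  case (prel i j u v)
  then show ?case using peq.prel[of i n j M "x @ u" "v @ y"] by simp
qed (blast intro: peq.psym peq.ptrans)+

lemma peq_append_left: "u \<approx> v \<Longrightarrow> x @ u \<approx> x @ v"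
  using peq_context[of u v x "[]"] by simp

lemma peq_append_right: "u \<approx> v \<Longrightarrow> u @ y \<approx> v @ y"
  using peq_context[of u v "[]" y] by simp

lemma peq_append: "u \<approx> u' \<Longrightarrow> v \<approx> v' \<Longrightarrow> u @ v \<approx> u' @ v'"
  by (meson peq_append_left peq_append_right peq.ptrans)

lemma peq_Cons: "u \<approx> v \<Longrightarrow> a # u \<approx> a # v"
  using peq_append_left[of u v "[a]"] by simp

lemma peq_length: "u \<approx> v \<Longrightarrow> length u = length v"
  by (induction rule: peq.induct) auto

lemma peq_pos_word: "u \<approx> v \<Longrightarrow> pos_word n u \<longleftrightarrow> pos_word n v"
proof (induction rule: peq.induct)
  case (prel i j u v)
  then show ?case using set_alt[of i j "M i j"] set_alt[of j i "M i j"]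
    by (auto simp: pos_word_def)
qed auto

lemma peq_alt: "i < n \<Longrightarrow> j < n \<Longrightarrow> i \<noteq> j \<Longrightarrow> alt i j (M i j) \<approx> alt j i (M i j)"
  using peq.prel[of i n j M "[]" "[]"] by simp

lemma commute_letters: "i < n \<Longrightarrow> j < n \<Longrightarrow> i \<noteq> j \<Longrightarrow> M i j = 2 \<Longrightarrow> [i, j] \<approx> [j, i]"
  using peq_alt[of i j] by (simp add: numeral_2_eq_2)

lemma commute_words:
  assumes "\<And>x y. x \<in> set p \<Longrightarrow> y \<in> set q \<Longrightarrow> [x, y] \<approx> [y, x]"
  shows "p @ q \<approx> q @ p"
  using assms
proof (induction p)
  case (Cons x p)
  have "x # q \<approx> q @ [x]"
    using Cons.prems(1)[of x]
  proof (induction q)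
    case (Cons y q)
    have "[x, y] @ q \<approx> [y, x] @ q" using Cons.prems by (intro peq_append_right) simp
    also have "\<dots> \<approx> y # q @ [x]" using Cons by (auto intro: peq_Cons)
    finally show ?case by simp
  qed simp
  then have "x # q @ p \<approx> q @ x # p" using peq_append_right[of "x # q" "q @ [x]" p] by simp
  moreover have "x # p @ q \<approx> x # q @ p" using Cons by (auto intro: peq_Cons)
  ultimately show ?case by (auto intro: peq.ptrans)
qed simp

definition ldvd :: "nat list \<Rightarrow> nat list \<Rightarrow> bool" (infix "\<preceq>" 50) where
  "u \<preceq> w \<longleftrightarrow> (\<exists>v. u @ v \<approx> w)"

lemma ldvdI: "u @ v \<approx> w \<Longrightarrow> u \<preceq> w"
  by (auto simp: ldvd_def)

lemma ldvd_append [simp]: "u \<preceq> u @ v"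
  by (auto simp: ldvd_def)

lemma ldvd_Nil [simp]: "[] \<preceq> w"
  using ldvd_append[of "[]"] by simp

lemma ldvd_refl [simp]: "u \<preceq> u"
  using ldvd_append[of u "[]"] by simp

lemma ldvd_peq: "u \<preceq> w \<Longrightarrow> w \<approx> w' \<Longrightarrow> u \<preceq> w'"
  by (auto simp: ldvd_def intro: peq.ptrans)

lemma ldvd_trans: "u \<preceq> v \<Longrightarrow> v \<preceq> w \<Longrightarrow> u \<preceq> w"
  unfolding ldvd_def by (metis append_assoc peq.ptrans peq_append_right)

lemma ldvd_append_left: "u \<preceq> w \<Longrightarrow> x @ u \<preceq> x @ w"
  by (auto simp: ldvd_def intro: peq_append_left)

lemma ldvd_append_right: "u \<preceq> v \<Longrightarrow> u \<preceq> v @ w"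
  using ldvd_trans ldvd_append by blast

end

locale coxeter_matrix = artin_monoid +
  assumes sym: "i < n \<Longrightarrow> j < n \<Longrightarrow> i \<noteq> j \<Longrightarrow> M i j = M j i"
    and ge2: "i < n \<Longrightarrow> j < n \<Longrightarrow> i \<noteq> j \<Longrightarrow> M i j \<ge> 2"
begin

lemma peq_rev:
  assumes "u \<approx> v"
  shows "rev u \<approx> rev v"
  using assms
proof induction
  case (prel i j u v)
  have "rev v @ alt i j (M i j) @ rev u \<approx> rev v @ alt j i (M i j) @ rev u"
    using prel by (intro peq.prel)
  then show ?case by (auto simp: rev_alt intro: peq.psym)
qed (blast intro: peq.psym peq.ptrans)+

end

section \<open>Right least common multiples\<close>

text \<open>\<open>right_compl M a b\<close> completes \<open>a\<close> to the least common right multiple of \<open>a\<close> and \<open>b\<close>.\<close>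

definition right_compl :: "(nat \<Rightarrow> nat \<Rightarrow> nat) \<Rightarrow> nat \<Rightarrow> nat \<Rightarrow> nat list" where
  "right_compl M a b = (if a = b then [] else alt b a (M a b - 1))"

lemma right_compl_same [simp]: "right_compl M a a = []"
  by (simp add: right_compl_def)

lemma set_right_compl: "set (right_compl M a b) \<subseteq> {a, b}"
  using set_alt[of b a "M a b - 1"] by (auto simp: right_compl_def)

context coxeter_matrix
begin

lemma right_compl_commuting:
  "a < n \<Longrightarrow> b < n \<Longrightarrow> a \<noteq> b \<Longrightarrow> M a b = 2 \<Longrightarrow> right_compl M a b = [b] \<and> right_compl M b a = [a]"
  using sym[of a b] by (simp add: right_compl_def)

lemma right_compl_peq:
  assumes "a = b \<or> a < n \<and> b < n"
  shows "a # right_compl M a b \<approx> b # right_compl M b a"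
proof (cases "a = b")
  case False
  then have ab: "a < n" "b < n" using assms by auto
  obtain m where "M a b = Suc m" using ge2[OF ab False] by (cases "M a b") auto
  then show ?thesis
    using peq_alt[OF ab False] sym[OF ab False] False by (auto simp: right_compl_def intro: peq.psym)
qed simp

definition head_lcm :: "nat \<Rightarrow> nat \<Rightarrow> nat list \<Rightarrow> nat list \<Rightarrow> bool" where
  "head_lcm a b X Y \<longleftrightarrow> (a = b \<or> a < n \<and> b < n) \<and>
     (\<exists>T. X \<approx> right_compl M a b @ T \<and> Y \<approx> right_compl M b a @ T)"

lemma head_lcm_sym: "head_lcm a b X Y \<Longrightarrow> head_lcm b a Y X"
  by (auto simp: head_lcm_def)

definition head_division_upto :: "nat \<Rightarrow> bool" where
  "head_division_upto N \<longleftrightarrow>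
     (\<forall>a b X Y. length X < N \<longrightarrow> a # X \<approx> b # Y \<longrightarrow> head_lcm a b X Y)"

text \<open>\<open>p @ s\<close> and \<open>q @ t\<close> represent the least common right multiple of \<open>p\<close> and \<open>q\<close>. Leastness is
  demanded only as far as it follows from head division up to the length of the multiple at hand, so
  that the notion can be used in the induction that establishes head division.\<close>

definition right_lcm :: "nat list \<Rightarrow> nat list \<Rightarrow> nat list \<Rightarrow> nat list \<Rightarrow> bool" where
  "right_lcm p q s t \<longleftrightarrow> p @ s \<approx> q @ t \<and>
     (\<forall>N U V. head_division_upto N \<longrightarrow> length (p @ U) \<le> N \<longrightarrow> p @ U \<approx> q @ V \<longrightarrow>
        (\<exists>T. U \<approx> s @ T \<and> V \<approx> t @ T))"

lemma right_lcmI: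
  assumes "p @ s \<approx> q @ t"
    and "\<And>N U V. head_division_upto N \<Longrightarrow> length (p @ U) \<le> N \<Longrightarrow> p @ U \<approx> q @ V \<Longrightarrow>
      \<exists>T. U \<approx> s @ T \<and> V \<approx> t @ T"
  shows "right_lcm p q s t"
  using assms by (auto simp: right_lcm_def)

lemma right_lcm_peq: "right_lcm p q s t \<Longrightarrow> p @ s \<approx> q @ t"
  by (simp add: right_lcm_def)

lemma right_lcm_least:
  assumes "right_lcm p q s t" "head_division_upto N" "length (p @ U) \<le> N" "p @ U \<approx> q @ V"
  obtains T where "U \<approx> s @ T" "V \<approx> t @ T"
  using assms unfolding right_lcm_def by blast

lemma right_lcm_sym:
  assumes "right_lcm p q s t"
  shows "right_lcm q p t s"
proof (rule right_lcmI)
  show "q @ t \<approx> p @ s" using right_lcm_peq[OF assms] by (rule peq.psym)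
  fix N U V assume "head_division_upto N" "length (q @ U) \<le> N" "q @ U \<approx> p @ V"
  then show "\<exists>T. U \<approx> t @ T \<and> V \<approx> s @ T"
    using right_lcm_least[OF assms, of N V U] peq_length[of "q @ U" "p @ V"] by (metis peq.psym)
qed

lemma right_lcm_Nil_left: "right_lcm [] q q []"
  by (rule right_lcmI) auto

lemma right_lcm_Nil_right: "right_lcm p [] [] p"
  by (rule right_lcm_sym[OF right_lcm_Nil_left])

lemma right_lcm_letters:
  assumes "a = b \<or> a < n \<and> b < n"
  shows "right_lcm [a] [b] (right_compl M a b) (right_compl M b a)"
  using right_compl_peq[OF assms] by (auto simp: right_lcm_def head_division_upto_def head_lcm_def)

lemma right_lcm_append:
  assumes "right_lcm p q s t" "right_lcm p' s s' t'"
  shows "right_lcm (p @ p') q s' (t @ t')"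
proof (rule right_lcmI)
  have "p @ p' @ s' \<approx> (p @ s) @ t'" using peq_append_left[OF right_lcm_peq[OF assms(2)]] by simp
  also have "\<dots> \<approx> (q @ t) @ t'" by (rule peq_append_right[OF right_lcm_peq[OF assms(1)]])
  finally show "(p @ p') @ s' \<approx> q @ t @ t'" by simp
next
  fix N U V assume N: "head_division_upto N" "length ((p @ p') @ U) \<le> N" "(p @ p') @ U \<approx> q @ V"
  then obtain T where T: "p' @ U \<approx> s @ T" "V \<approx> t @ T"
    using right_lcm_least[OF assms(1), of N "p' @ U" V] by auto
  obtain T' where "U \<approx> s' @ T'" "T \<approx> t' @ T'"
    using right_lcm_least[OF assms(2) N(1) _ T(1)] N(2) by auto
  then show "\<exists>T. U \<approx> s' @ T \<and> V \<approx> (t @ t') @ T"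
    using T(2) peq_append_left[of T "t' @ T'" t] by (auto intro: peq.ptrans)
qed

lemma right_lcm_Cons_Cons:
  assumes "a = b \<or> a < n \<and> b < n"
    and "right_lcm p (right_compl M a b) s t" "right_lcm q (right_compl M b a @ t) s' t'"
  shows "right_lcm (a # p) (b # q) (s @ t') s'"
proof -
  have "right_lcm ([a] @ p) [b] s (right_compl M b a @ t)"
    by (rule right_lcm_append[OF right_lcm_letters[OF assms(1)] assms(2)])
  from right_lcm_append[OF right_lcm_sym[OF this] assms(3)] show ?thesis
    using right_lcm_sym by simp
qed

lemma right_lcm_same: "right_lcm p p [] []"
proof (induction p)
  case (Cons a p)
  show ?case
    using right_lcm_Cons_Cons[of a a p "[]" p p "[]" "[]"] Cons right_lcm_Nil_right by simp
qed (rule right_lcm_Nil_left)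

lemma right_lcm_commuting:
  assumes "b < n" "\<And>x. x \<in> set p \<Longrightarrow> x < n \<and> x \<noteq> b \<and> M x b = 2"
  shows "right_lcm p [b] [b] p"
  using assms(2)
proof (induction p)
  case (Cons a p)
  have "right_lcm [a] [b] [b] [a]"
    using right_lcm_letters[of a b] right_compl_commuting[of a b] assms(1) Cons.prems by simp
  from right_lcm_append[OF this Cons.IH] show ?case using Cons.prems by simp
qed (rule right_lcm_Nil_left)

text \<open>The cube condition allows the division of a word by \<open>a\<close> and \<open>c\<close> to be composed with its division
  by \<open>c\<close> and \<open>b\<close>.\<close>

definition cube :: "nat \<Rightarrow> nat \<Rightarrow> nat \<Rightarrow> bool" where
  "cube a b c \<longleftrightarrow> (\<exists>s t r. right_lcm (right_compl M c a) (right_compl M c b) s t \<and>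
     right_compl M a c @ s \<approx> right_compl M a b @ r \<and> right_compl M b c @ t \<approx> right_compl M b a @ r)"

lemma cubeI:
  assumes "right_lcm (right_compl M c a) (right_compl M c b) s t"
    and "right_compl M a c @ s \<approx> right_compl M a b @ r"
    and "right_compl M b c @ t \<approx> right_compl M b a @ r"
  shows "cube a b c"
  using assms unfolding cube_def by blast

lemma cube_sym: "cube a b c \<Longrightarrow> cube b a c"
  unfolding cube_def using right_lcm_sym by blast

lemma head_lcm_trans:
  assumes "head_lcm a c X Z" "head_lcm c b Z Y" "head_division_upto N" "length Z \<le> N" "cube a b c"
  shows "head_lcm a b X Y"
proof -
  obtain U where U: "X \<approx> right_compl M a c @ U" "Z \<approx> right_compl M c a @ U"
    using assms(1) by (auto simp: head_lcm_def)
  obtain V where V: "Z \<approx> right_compl M c b @ V" "Y \<approx> right_compl M b c @ V"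
    using assms(2) by (auto simp: head_lcm_def)
  obtain s t r where lcm: "right_lcm (right_compl M c a) (right_compl M c b) s t"
    and r: "right_compl M a c @ s \<approx> right_compl M a b @ r" "right_compl M b c @ t \<approx> right_compl M b a @ r"
    using assms(5) by (auto simp: cube_def)
  have "right_compl M c a @ U \<approx> right_compl M c b @ V"
    using U(2) V(1) by (blast intro: peq.psym peq.ptrans)
  then obtain T where T: "U \<approx> s @ T" "V \<approx> t @ T"
    using right_lcm_least[OF lcm assms(3)] peq_length[OF U(2)] assms(4) by metis
  have "X \<approx> (right_compl M a c @ s) @ T"
    using peq.ptrans[OF U(1) peq_append_left[OF T(1)]] by simp
  also have "\<dots> \<approx> right_compl M a b @ r @ T" using peq_append_right[OF r(1)] by simp
  finally have "X \<approx> right_compl M a b @ r @ T" .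
  moreover have "Y \<approx> (right_compl M b c @ t) @ T"
    using peq.ptrans[OF V(2) peq_append_left[OF T(2)]] by simp
  then have "Y \<approx> right_compl M b a @ r @ T"
    using peq_append_right[OF r(2), of T] by (auto intro: peq.ptrans)
  ultimately show ?thesis using assms(1,2) by (auto simp: head_lcm_def)
qed

lemma cube_degenerate:
  assumes "a = b \<or> a = c \<or> b = c"
  shows "cube a b c"
proof -
  have "cube a b a" for a b
    by (rule cubeI[where s = "right_compl M a b" and t = "[]" and r = "[]"])
      (simp_all add: right_lcm_Nil_left)
  moreover have "cube a a c" for a c
    by (rule cubeI[OF right_lcm_same, of _ _ "right_compl M a c"]) simp_all
  ultimately show ?thesis using assms cube_sym by blast
qed

lemma cube_commuting_apex:
  assumes "a < n" "b < n" "c < n" "a \<noteq> c" "b \<noteq> c" "M a c = 2" "M b c = 2"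
  shows "cube a b c"
proof (rule cubeI)
  have compl: "right_compl M c a = [a]" "right_compl M a c = [c]"
    "right_compl M c b = [b]" "right_compl M b c = [c]"
    using right_compl_commuting[of a c] right_compl_commuting[of b c] assms by auto
  show "right_lcm (right_compl M c a) (right_compl M c b) (right_compl M a b) (right_compl M b a)"
    unfolding compl using assms(1,2) by (intro right_lcm_letters) simp
  have "[c] @ right_compl M x y \<approx> right_compl M x y @ [c]" if "x \<in> {a, b}" "y \<in> {a, b}" for x y
    using set_right_compl[of M x y] that assms commute_letters
    by (intro commute_words) (auto intro: peq.psym)
  then show "right_compl M a c @ right_compl M a b \<approx> right_compl M a b @ [c]"
    "right_compl M b c @ right_compl M b a \<approx> right_compl M b a @ [c]"
    unfolding compl by blast+
qed

lemma cube_commuting_side: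
  assumes "a < n" "b < n" "c < n" "a \<noteq> b" "b \<noteq> c" "M a b = 2" "M c b = 2"
  shows "cube a b c"
proof (rule cubeI)
  have compl: "right_compl M a b = [b]" "right_compl M b a = [a]"
    "right_compl M c b = [b]" "right_compl M b c = [c]"
    using right_compl_commuting[of a b] right_compl_commuting[of c b] assms by auto
  show "right_lcm (right_compl M c a) (right_compl M c b) [b] (right_compl M c a)"
    unfolding compl using set_right_compl[of M c a] assms by (intro right_lcm_commuting) auto
  show "right_compl M a c @ [b] \<approx> right_compl M a b @ right_compl M a c"
    unfolding compl using set_right_compl[of M a c] assms commute_letters by (intro commute_words) auto
  show "right_compl M b c @ right_compl M c a \<approx> right_compl M b a @ right_compl M a c"
    unfolding compl using right_compl_peq[of c a] assms by simp
qed

end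

text \<open>The result completes \<open>p\<close> and \<open>q\<close> to their least common right multiple. Word reversing need not
  terminate; \<open>f\<close> bounds the recursion depth.\<close>

fun reversing :: "(nat \<Rightarrow> nat \<Rightarrow> nat) \<Rightarrow> nat \<Rightarrow> nat list \<Rightarrow> nat list \<Rightarrow> (nat list \<times> nat list) option" where
  "reversing L f [] q = Some (q, [])"
| "reversing L f (a # p) [] = Some ([], a # p)"
| "reversing L 0 (a # p) (b # q) = None"
| "reversing L (Suc f) (a # p) (b # q) = do {
     (s, t) \<leftarrow> reversing L f p (right_compl L a b);
     (s', t') \<leftarrow> reversing L f q (right_compl L b a @ t);
     Some (s @ t', s')
   }"

lemma set_reversing:
  "reversing L f p q = Some (s, t) \<Longrightarrow> set s \<union> set t \<subseteq> set p \<union> set q"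
proof (induction f arbitrary: p q s t)
  case 0
  then show ?case by (cases p; cases q) auto
next
  case (Suc f)
  consider "p = [] \<or> q = []" | a p' b q' where "p = a # p'" "q = b # q'" by (meson neq_Nil_conv)
  then show ?case
  proof cases
    case 1
    then show ?thesis using Suc.prems by (cases p; cases q) auto
  next
    case 2
    obtain s1 t1 t2 where "s = s1 @ t2" "reversing L f p' (right_compl L a b) = Some (s1, t1)"
      "reversing L f q' (right_compl L b a @ t1) = Some (t, t2)"
      using Suc.prems by (auto simp: 2 Option.bind_eq_Some_conv)
    then show ?thesis
      using Suc.IH[of p' "right_compl L a b" s1 t1] Suc.IH[of q' "right_compl L b a @ t1" t t2]
        set_right_compl[of L a b] set_right_compl[of L b a] by (fastforce simp: 2)
  qed
qed

definition coxeter_embedding ::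
    "(nat \<Rightarrow> nat) \<Rightarrow> nat \<Rightarrow> (nat \<Rightarrow> nat \<Rightarrow> nat) \<Rightarrow> nat \<Rightarrow> (nat \<Rightarrow> nat \<Rightarrow> nat) \<Rightarrow> bool" where
  "coxeter_embedding g k L n M \<longleftrightarrow> inj_on g {..<k} \<and> g ` {..<k} \<subseteq> {..<n} \<and>
     (\<forall>i<k. \<forall>j<k. i \<noteq> j \<longrightarrow> M (g i) (g j) = L i j)"

lemma coxeter_embeddingD:
  assumes "coxeter_embedding g k L n M"
  shows "i < k \<Longrightarrow> g i < n"
    and "i < k \<Longrightarrow> j < k \<Longrightarrow> g i = g j \<longleftrightarrow> i = j"
    and "i < k \<Longrightarrow> j < k \<Longrightarrow> i \<noteq> j \<Longrightarrow> M (g i) (g j) = L i j"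
  using assms by (auto simp: coxeter_embedding_def inj_on_def)

lemma map_right_compl:
  assumes "coxeter_embedding g k L n M" "a < k" "b < k"
  shows "map g (right_compl L a b) = right_compl M (g a) (g b)"
  using coxeter_embeddingD(2,3)[OF assms] by (auto simp: right_compl_def map_alt)

text \<open>The labels of the edges 01, 02, 12 for the types \<open>A\<^sub>3\<close>, \<open>B\<^sub>3\<close>, \<open>H\<^sub>3\<close> under all numberings of the
  vertices.\<close>

definition connected_rank3_labels :: "(nat \<times> nat \<times> nat) list" where
  "connected_rank3_labels =
     concat (map (\<lambda>q. [(2, 3, q), (3, 2, q), (2, q, 3), (3, q, 2), (q, 2, 3), (q, 3, 2)]) [3, 4, 5])"

definition spherical_triple :: "nat \<Rightarrow> nat \<Rightarrow> nat \<Rightarrow> bool" where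
  "spherical_triple x y z \<longleftrightarrow> x = 2 \<and> y = 2 \<or> x = 2 \<and> z = 2 \<or> y = 2 \<and> z = 2 \<or>
     (x, y, z) \<in> set connected_rank3_labels"

lemma diag_lab_simps [simp, code]:
  "diag_lab [] i j = 2"
  "diag_lab ((a, b, m) # es) i j =
     (if a = i \<and> b = j \<or> a = j \<and> b = i then m else diag_lab es i j)"
  by (auto simp: diag_lab_def doubleton_eq_iff)

definition cube_check :: "(nat \<Rightarrow> nat \<Rightarrow> nat) \<Rightarrow> nat \<Rightarrow> nat \<Rightarrow> nat \<Rightarrow> nat \<Rightarrow> bool" where
  "cube_check L f a b c \<longleftrightarrow>
    do {
      (s, t) \<leftarrow> reversing L f (right_compl L c a) (right_compl L c b);
      (x, r) \<leftarrow> reversing L f (right_compl L a c @ s) (right_compl L a b);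
      (y, z) \<leftarrow> reversing L f (right_compl L b c @ t) (right_compl L b a @ r);
      Some (x, y, z)
    } = Some ([], [], [])"

lemma rank3_cube_check:
  "list_all (\<lambda>(x, y, z). cube_check (diag_lab [(0, 1, x), (0, 2, y), (1, 2, z)]) 20 0 1 2)
     connected_rank3_labels"
  by code_simp

context coxeter_matrix
begin

lemma right_lcm_reversing:
  assumes "coxeter_embedding g k L n M"
    and "reversing L f p q = Some (s, t)" "set p \<union> set q \<subseteq> {..<k}"
  shows "right_lcm (map g p) (map g q) (map g s) (map g t)"
  using assms(2,3)
proof (induction f arbitrary: p q s t)
  case 0
  then show ?case
    by (cases p; cases q) (auto simp: right_lcm_Nil_left right_lcm_Nil_right)
next
  case (Suc f)
  consider "p = [] \<or> q = []" | a p' b q' where "p = a # p'" "q = b # q'" by (meson neq_Nil_conv)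
  then show ?case
  proof cases
    case 1
    then show ?thesis
      using Suc.prems by (cases p; cases q) (auto simp: right_lcm_Nil_left right_lcm_Nil_right)
  next
    case 2
    obtain s1 t1 t2 where s: "s = s1 @ t2"
      and rev_p: "reversing L f p' (right_compl L a b) = Some (s1, t1)"
      and rev_q: "reversing L f q' (right_compl L b a @ t1) = Some (t, t2)"
      using Suc.prems(1) by (auto simp: 2 Option.bind_eq_Some_conv)
    have letters: "a < k" "b < k" "set p' \<subseteq> {..<k}" "set q' \<subseteq> {..<k}"
      "set (right_compl L a b) \<subseteq> {..<k}" "set (right_compl L b a) \<subseteq> {..<k}"
      using Suc.prems(2) set_right_compl[of L a b] set_right_compl[of L b a] by (auto simp: 2)
    have "set t1 \<subseteq> {..<k}" using set_reversing[OF rev_p] letters by auto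
    then have "right_lcm (map g p') (right_compl M (g a) (g b)) (map g s1) (map g t1)"
      "right_lcm (map g q') (right_compl M (g b) (g a) @ map g t1) (map g t) (map g t2)"
      using Suc.IH[OF rev_p] Suc.IH[OF rev_q] letters map_right_compl[OF assms(1)] by simp_all
    then show ?thesis
      using right_lcm_Cons_Cons coxeter_embeddingD(1)[OF assms(1)] letters(1,2) by (simp add: 2 s)
  qed
qed

lemma cube_checkD:
  assumes g: "coxeter_embedding g k L n M" and "a < k" "b < k" "c < k" and "cube_check L f a b c"
  shows "cube (g a) (g b) (g c)"
proof -
  obtain s t r where st: "reversing L f (right_compl L c a) (right_compl L c b) = Some (s, t)"
    and r: "reversing L f (right_compl L a c @ s) (right_compl L a b) = Some ([], r)"
    and eq: "reversing L f (right_compl L b c @ t) (right_compl L b a @ r) = Some ([], [])"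
    using assms(5) by (auto simp: cube_check_def Option.bind_eq_Some_conv)
  have letters: "set (right_compl L x y) \<subseteq> {..<k}" if "x \<in> {a, b, c}" "y \<in> {a, b, c}" for x y
    using set_right_compl[of L x y] that assms(2-4) by auto
  have "set s \<union> set t \<subseteq> {..<k}" using set_reversing[OF st] letters[of c a] letters[of c b] by auto
  moreover from this have "set r \<subseteq> {..<k}"
    using set_reversing[OF r] letters[of a c] letters[of a b] by auto
  ultimately have
    "right_lcm (right_compl M (g c) (g a)) (right_compl M (g c) (g b)) (map g s) (map g t)"
    "right_lcm (right_compl M (g a) (g c) @ map g s) (right_compl M (g a) (g b)) [] (map g r)"
    "right_lcm (right_compl M (g b) (g c) @ map g t) (right_compl M (g b) (g a) @ map g r) [] []"
    using right_lcm_reversing[OF g st] right_lcm_reversing[OF g r] right_lcm_reversing[OF g eq]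
      letters assms(2-4) by (simp_all add: map_right_compl[OF g])
  from this(1) right_lcm_peq[OF this(2)] right_lcm_peq[OF this(3)] show ?thesis
    by (intro cubeI) simp_all
qed

lemma cube_rank3:
  assumes "a < n" "b < n" "c < n" "distinct [a, b, c]"
    and "(M a b, M a c, M b c) \<in> set connected_rank3_labels"
  shows "cube a b c"
proof -
  define L where "L = diag_lab [(0, 1, M a b), (0, 2, M a c), (1, 2, M b c)]"
  define g where "g = (!) [a, b, c]"
  have "M (g i) (g j) = L i j" if "i < 3" "j < 3" "i \<noteq> j" for i j
  proof -
    have "i \<in> {0, 1, 2}" "j \<in> {0, 1, 2}" using that by auto
    then show ?thesis
      using that assms(4) sym[OF assms(2,1)] sym[OF assms(3,1)] sym[OF assms(3,2)]
      by (elim insertE emptyE) (simp_all add: g_def L_def)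
  qed
  then have "coxeter_embedding g 3 L n M"
    using assms(1-4)
    by (auto simp: coxeter_embedding_def g_def inj_on_nth less_Suc_eq numeral_3_eq_3)
  moreover have "cube_check L 20 0 1 2"
    using rank3_cube_check assms(5) unfolding list_all_iff L_def by blast
  ultimately have "cube (g 0) (g 1) (g 2)" using cube_checkD[of g 3 L 0 1 2 20] by simp
  then show ?thesis by (simp add: g_def)
qed

end

locale spherical_triples = coxeter_matrix +
  assumes triples: "a < n \<Longrightarrow> b < n \<Longrightarrow> c < n \<Longrightarrow> distinct [a, b, c] \<Longrightarrow>
    spherical_triple (M a b) (M a c) (M b c)"
begin

lemma cube_all:
  assumes "a < n" "b < n" "c < n"
  shows "cube a b c"
proof (cases "distinct [a, b, c]")
  case True
  then have distinct: "a \<noteq> b" "a \<noteq> c" "b \<noteq> c" by auto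
  note symm = sym[of b a] sym[of c a] sym[of c b]
  consider "M a b = 2" "M a c = 2" | "M a b = 2" "M b c = 2" | "M a c = 2" "M b c = 2"
    | "(M a b, M a c, M b c) \<in> set connected_rank3_labels"
    using triples[OF assms True] by (auto simp: spherical_triple_def)
  then show ?thesis
  proof cases
    case 1
    then show ?thesis
      using cube_commuting_side[of b a c] assms distinct symm by (intro cube_sym[of b a c]) auto
  next
    case 2
    then show ?thesis using cube_commuting_side[of a b c] assms distinct symm by auto
  next
    case 3
    then show ?thesis using cube_commuting_apex[of a b c] assms distinct by auto
  next
    case 4
    then show ?thesis using cube_rank3 assms True by blast
  qed
qed (auto intro: cube_degenerate)

lemma head_lcm_braid_relation:
  fixes u v :: "nat list"
  assumes "i < n" "j < n" "i \<noteq> j"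
  defines "x \<equiv> u @ alt i j (M i j) @ v" and "y \<equiv> u @ alt j i (M i j) @ v"
  shows "head_lcm (hd x) (hd y) (tl x) (tl y)"
proof (cases u)
  case Nil
  obtain m where "M i j = Suc m" using ge2[OF assms(1-3)] by (cases "M i j") auto
  then show ?thesis
    using assms(1-3) sym[of i j] Nil by (auto simp: x_def y_def head_lcm_def right_compl_def)
next
  case (Cons a u')
  then show ?thesis
    using assms(1-3) peq.prel[of i n j M u' v] by (auto simp: x_def y_def head_lcm_def)
qed

lemma head_division_upto_all: "head_division_upto N"
proof (induction N)
  case 0
  show ?case by (simp add: head_division_upto_def)
next
  case (Suc N)
  have "head_lcm (hd u) (hd v) (tl u) (tl v)" if "u \<approx> v" "u \<noteq> []" "length u \<le> Suc N" for u v
    using that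
  proof induction
    case (prefl u)
    show ?case by (auto simp: head_lcm_def)
  next
    case (psym u v)
    then have "u \<noteq> []" "length u \<le> Suc N" using peq_length[of u v] by auto
    then show ?case using psym.IH by (blast intro: head_lcm_sym)
  next
    case (ptrans u v w)
    have len: "length u = length v" using ptrans.hyps(1) by (rule peq_length)
    have heads: "head_lcm (hd u) (hd v) (tl u) (tl v)" "head_lcm (hd v) (hd w) (tl v) (tl w)"
      using ptrans.IH ptrans.prems len by (metis length_0_conv)+
    then have "cube (hd u) (hd w) (hd v)"
      using cube_degenerate[of "hd u" "hd w" "hd v"] cube_all[of "hd u" "hd w" "hd v"]
      by (auto simp: head_lcm_def)
    then show ?case using head_lcm_trans[OF heads Suc.IH] ptrans.prems len by auto
  next
    case (prel i j u v)
    then show ?case by (intro head_lcm_braid_relation)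
  qed
  from this[of "_ # _" "_ # _"] show ?case unfolding head_division_upto_def by auto
qed

lemma head_division:
  assumes "a # X \<approx> b # Y"
  obtains T where "X \<approx> right_compl M a b @ T" "Y \<approx> right_compl M b a @ T" "a = b \<or> a < n \<and> b < n"
proof -
  have "head_lcm a b X Y"
    using assms head_division_upto_all[of "Suc (length X)"] by (auto simp: head_division_upto_def)
  then show thesis using that by (auto simp: head_lcm_def)
qed

lemma right_lcm_dvd:
  assumes "right_lcm p q s t" "p \<preceq> W" "q \<preceq> W"
  shows "p @ s \<preceq> W"
proof -
  obtain U V where U: "p @ U \<approx> W" and V: "q @ V \<approx> W" using assms(2,3) by (auto simp: ldvd_def)
  have "p @ U \<approx> q @ V" using U V by (blast intro: peq.psym peq.ptrans)
  then obtain T where "U \<approx> s @ T"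
    using right_lcm_least[OF assms(1) head_division_upto_all order.refl] by blast
  then have "(p @ s) @ T \<approx> p @ U" using peq_append_left peq.psym by simp
  then show ?thesis using U by (blast intro: ldvdI peq.ptrans)
qed

lemma right_lcm_exists:
  assumes "p @ U \<approx> q @ V"
  shows "\<exists>s t. right_lcm p q s t"
  using assms
proof (induction "length (p @ U)" arbitrary: p q U V rule: less_induct)
  case less
  consider "p = []" | "q = []" | a p' b q' where "p = a # p'" "q = b # q'" by (meson neq_Nil_conv)
  then show ?case
  proof cases
    case 3
    obtain T where T: "p' @ U \<approx> right_compl M a b @ T" "q' @ V \<approx> right_compl M b a @ T"
      and ab: "a = b \<or> a < n \<and> b < n"
      using head_division[of a "p' @ U" b "q' @ V"] less.prems 3 by auto
    obtain s t where st: "right_lcm p' (right_compl M a b) s t"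
      using less.hyps[OF _ T(1)] 3 by auto
    obtain R where R: "U \<approx> s @ R" "T \<approx> t @ R"
      using right_lcm_least[OF st head_division_upto_all order.refl T(1)] .
    have "q' @ V \<approx> (right_compl M b a @ t) @ R"
      using peq.ptrans[OF T(2) peq_append_left[OF R(2)]] by simp
    moreover have "length (q' @ V) < length (p @ U)" using peq_length[OF less.prems] 3 by simp
    ultimately obtain s' t' where "right_lcm q' (right_compl M b a @ t) s' t'"
      using less.hyps by blast
    with right_lcm_Cons_Cons[OF ab st] show ?thesis using 3 by blast
  qed (auto intro: right_lcm_Nil_left right_lcm_Nil_right)
qed

lemma lcm_exists:
  assumes "p \<preceq> W" "q \<preceq> W"
  obtains m where "p \<preceq> m" "q \<preceq> m" "\<And>W. p \<preceq> W \<Longrightarrow> q \<preceq> W \<Longrightarrow> m \<preceq> W"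
proof -
  obtain U V where "p @ U \<approx> W" "q @ V \<approx> W" using assms by (auto simp: ldvd_def)
  then have "p @ U \<approx> q @ V" by (blast intro: peq.psym peq.ptrans)
  then obtain s t where st: "right_lcm p q s t" using right_lcm_exists by blast
  then have "q \<preceq> p @ s" using right_lcm_peq by (blast intro: ldvdI peq.psym)
  then show thesis using that[of "p @ s"] right_lcm_dvd[OF st] by simp
qed

lemma finite_lcm_exists:
  assumes "finite A" "\<forall>p\<in>A. p \<preceq> W"
  shows "\<exists>m. (\<forall>p\<in>A. p \<preceq> m) \<and> (\<forall>W. (\<forall>p\<in>A. p \<preceq> W) \<longrightarrow> m \<preceq> W)"
  using assms
proof (induction rule: finite_induct)
  case empty
  show ?case by (intro exI[of _ "[]"]) simp
next
  case (insert p A)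
  then obtain m where m: "\<forall>q\<in>A. q \<preceq> m" "\<And>W. \<forall>q\<in>A. q \<preceq> W \<Longrightarrow> m \<preceq> W" by blast
  have "p \<preceq> W" "m \<preceq> W" using insert.prems m(2) by blast+
  then obtain m' where m': "p \<preceq> m'" "m \<preceq> m'" "\<And>W. p \<preceq> W \<Longrightarrow> m \<preceq> W \<Longrightarrow> m' \<preceq> W"
    using lcm_exists by blast
  have "\<forall>q\<in>insert p A. q \<preceq> m'" using m(1) m'(1,2) ldvd_trans by blast
  moreover have "m' \<preceq> W" if "\<forall>q\<in>insert p A. q \<preceq> W" for W using that m(2) m'(3) by blast
  ultimately show ?case by blast
qed

end

section \<open>The Garside element\<close>

context artin_monoid
begin

definition common_multiple :: "nat set \<Rightarrow> nat list \<Rightarrow> bool" where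
  "common_multiple S W \<longleftrightarrow> set W \<subseteq> S \<and> (\<forall>i\<in>S. [i] \<preceq> W)"

definition has_common_multiple :: "nat set \<Rightarrow> bool" where
  "has_common_multiple S \<longleftrightarrow> (\<exists>W. common_multiple S W)"

end

context coxeter_matrix
begin

lemma rdvd_iff_ldvd_rev:
  assumes "pos_word n W"
  shows "(\<exists>u. pos_word n u \<and> u @ v \<approx> W) \<longleftrightarrow> rev v \<preceq> rev W"
proof
  assume "\<exists>u. pos_word n u \<and> u @ v \<approx> W"
  then show "rev v \<preceq> rev W" using peq_rev[of "_ @ v"] by (auto intro: ldvdI)
next
  assume "rev v \<preceq> rev W"
  then obtain u where "rev v @ u \<approx> rev W" by (auto simp: ldvd_def)
  from peq_rev[OF this] have u: "rev u @ v \<approx> W" by simp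
  then have "pos_word n (rev u)"
    using peq_pos_word[OF u] assms by (auto simp: pos_word_def)
  then show "\<exists>u. pos_word n u \<and> u @ v \<approx> W" using u by blast
qed

lemma common_left_mult_iff: "common_left_mult n M W \<longleftrightarrow> common_multiple {..<n} (rev W)"
  unfolding common_left_mult_def common_multiple_def
  using rdvd_iff_ldvd_rev[of W "[_]"] by (auto simp: pos_word_def)

lemma is_garside_iff:
  "is_garside n M D \<longleftrightarrow> common_multiple {..<n} (rev D) \<and>
     (\<forall>W. common_multiple {..<n} W \<longrightarrow> rev D \<preceq> W)"
proof -
  have "(\<exists>v. pos_word n v \<and> v @ D \<approx> W) \<longleftrightarrow> rev D \<preceq> rev W" if "common_multiple {..<n} (rev W)" for W
    using that by (intro rdvd_iff_ldvd_rev) (simp add: common_multiple_def pos_word_def)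
  then have "is_garside n M D \<longleftrightarrow> common_multiple {..<n} (rev D) \<and>
      (\<forall>W. common_multiple {..<n} (rev W) \<longrightarrow> rev D \<preceq> rev W)"
    by (auto simp: is_garside_def common_left_mult_iff)
  then show ?thesis by (metis rev_rev_ident)
qed

end

context spherical_triples
begin

lemma is_garside_garside:
  assumes "common_multiple {..<n} W"
  shows "is_garside n M (garside n M)"
proof -
  obtain D where D: "\<forall>i\<in>{..<n}. [i] \<preceq> D" "\<forall>W. (\<forall>i\<in>{..<n}. [i] \<preceq> W) \<longrightarrow> D \<preceq> W"
    using finite_lcm_exists[of "(\<lambda>i. [i]) ` {..<n}" W] assms
    unfolding common_multiple_def ball_simps by blast
  then obtain v where v: "D @ v \<approx> W" using assms unfolding common_multiple_def ldvd_def by blast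
  then have "set D \<subseteq> {..<n}"
    using peq_pos_word[OF v] assms by (auto simp: common_multiple_def pos_word_def)
  then have "is_garside n M (rev D)"
    unfolding is_garside_iff using D by (auto simp: common_multiple_def)
  then show ?thesis unfolding garside_def by (rule someI)
qed

lemma alt_ldvd:
  assumes "[k] \<preceq> D" "[j] \<preceq> D" "j \<noteq> k"
  shows "alt k j (M k j) \<preceq> D"
proof -
  obtain U V where UV: "k # U \<approx> D" "j # V \<approx> D" using assms(1,2) by (auto simp: ldvd_def)
  then have "k # U \<approx> j # V" by (blast intro: peq.psym peq.ptrans)
  then obtain T where T: "U \<approx> right_compl M k j @ T" and jk: "j < n" "k < n"
    using head_division assms(3) by blast
  have "(k # right_compl M k j) @ T \<approx> D"
    using peq.ptrans[OF peq.psym[OF peq_Cons[OF T]] UV(1)] by simp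
  moreover obtain m where "M k j = Suc m" using ge2[of k j] assms(3) jk by (cases "M k j") auto
  then have "k # right_compl M k j = alt k j (M k j)" using assms(3) by (simp add: right_compl_def)
  ultimately show ?thesis using ldvdI by simp
qed

text \<open>\<open>j # D\<close> is divisible by every \<open>k\<close>, because \<open>D\<close> is divisible by the least common multiple of \<open>j\<close>
  and \<open>k\<close>. So it is a multiple of \<open>D\<close>, and the cofactor has length one.\<close>

lemma least_common_multiple_quasi_central:
  assumes D: "common_multiple {..<n} D" and least: "\<And>W. common_multiple {..<n} W \<Longrightarrow> D \<preceq> W"
    and j: "j < n"
  obtains j' where "j' < n" "j # D \<approx> D @ [j']"
proof -
  have "[k] \<preceq> j # D" if k: "k < n" for k
  proof (cases "j = k")
    case False
    let ?m = "M k j"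
    have "alt k j ?m \<preceq> D" using alt_ldvd[of k D j] D j k False by (auto simp: common_multiple_def)
    from ldvd_append_left[OF this, of "[j]"] have "alt j k (Suc ?m) \<preceq> j # D" by simp
    moreover have "[k] \<preceq> alt j k (Suc ?m)"
    proof (rule ldvd_peq)
      show "[k] \<preceq> alt k j ?m @ [if even ?m then j else k]"
        using ge2[OF k j] False ldvd_append[of "[k]"] by (cases ?m) auto
      show "alt k j ?m @ [if even ?m then j else k] \<approx> alt j k (Suc ?m)"
        unfolding alt_snoc using peq_alt[of k j] j k False by (intro peq_append_right) auto
    qed
    ultimately show ?thesis using ldvd_trans by blast
  qed (use ldvd_append[of "[k]" D] in simp)
  then have "common_multiple {..<n} (j # D)" using D j by (auto simp: common_multiple_def)
  then obtain v where v: "D @ v \<approx> j # D" using least by (auto simp: ldvd_def)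
  then have "length v = 1" using peq_length by fastforce
  then obtain j' where "v = [j']" by (auto simp: length_Suc_conv)
  moreover have "pos_word n v"
    using peq_pos_word[OF v] D j by (auto simp: common_multiple_def pos_word_def)
  ultimately show thesis using that[of j'] v by (auto simp: pos_word_def intro: peq.psym)
qed

lemma garside_quasi_central:
  assumes "common_multiple {..<n} W" "j < n"
  obtains j' where "j' < n" "garside n M @ [j] \<approx> j' # garside n M"
proof -
  let ?D = "rev (garside n M)"
  obtain j' where "j' < n" "j # ?D \<approx> ?D @ [j']"
    using least_common_multiple_quasi_central[of ?D j] is_garside_garside[OF assms(1)] assms(2)
    unfolding is_garside_iff by blast
  then show thesis using that[of j'] peq_rev[of "j # ?D" "?D @ [j']"] by simp
qed

end

section \<open>Common multiples of the generators\<close>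

context artin_monoid
begin

lemma has_common_multipleI:
  "set W \<subseteq> S \<Longrightarrow> (\<And>i. i \<in> S \<Longrightarrow> [i] \<preceq> W) \<Longrightarrow> has_common_multiple S"
  by (auto simp: has_common_multiple_def common_multiple_def)

lemma has_common_multipleE:
  assumes "has_common_multiple S"
  obtains W where "set W \<subseteq> S" "\<And>i. i \<in> S \<Longrightarrow> [i] \<preceq> W"
  using assms by (auto simp: has_common_multiple_def common_multiple_def)

lemma has_common_multiple_empty: "has_common_multiple {}"
  by (rule has_common_multipleI[of "[]"]) auto

lemma has_common_multiple_singleton: "has_common_multiple {i}"
  by (rule has_common_multipleI[of "[i]"]) auto

lemma has_common_multiple_Un:
  assumes "has_common_multiple S" "has_common_multiple T"
    and commute: "\<And>i j. i \<in> S \<Longrightarrow> j \<in> T \<Longrightarrow> [i, j] \<approx> [j, i]"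
  shows "has_common_multiple (S \<union> T)"
proof -
  obtain V where V: "set V \<subseteq> S" "\<And>i. i \<in> S \<Longrightarrow> [i] \<preceq> V"
    using assms(1) by (rule has_common_multipleE) blast
  obtain W where W: "set W \<subseteq> T" "\<And>j. j \<in> T \<Longrightarrow> [j] \<preceq> W"
    using assms(2) by (rule has_common_multipleE) blast
  have "[j] \<preceq> V @ W" if "j \<in> T" for j
  proof -
    have "V @ [j] \<approx> [j] @ V" using V(1) that commute by (intro commute_words) auto
    then have "[j] \<preceq> V @ [j]" by (blast intro: ldvdI peq.psym)
    moreover have "V @ [j] \<preceq> V @ W" using W(2)[OF that] by (rule ldvd_append_left)
    ultimately show ?thesis by (rule ldvd_trans)
  qed
  then show ?thesis using V W(1) ldvd_append_right by (intro has_common_multipleI[of "V @ W"]) auto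
qed

text \<open>If \<open>W\<close> is a common multiple of \<open>J\<close>, then \<open>\<delta> @ W\<close> is one of \<open>S\<close>.\<close>

lemma has_common_multiple_ribbon:
  assumes "has_common_multiple J" "J \<subseteq> S" "set \<delta> \<subseteq> S"
    and ribbon: "\<And>j. j \<in> S \<Longrightarrow> [j] \<preceq> \<delta> \<or> (\<exists>i\<in>J. \<delta> @ [i] \<approx> j # \<delta>)"
  shows "has_common_multiple S"
proof -
  obtain W where W: "set W \<subseteq> J" "\<And>i. i \<in> J \<Longrightarrow> [i] \<preceq> W"
    using assms(1) by (rule has_common_multipleE) blast
  have "[j] \<preceq> \<delta> @ W" if "j \<in> S" for j
    using ribbon[OF that]
  proof (elim disjE bexE)
    fix i assume i: "i \<in> J" "\<delta> @ [i] \<approx> j # \<delta>"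
    have "[j] \<preceq> \<delta> @ [i]" using peq.psym[OF i(2)] by (auto intro: ldvdI)
    moreover have "\<delta> @ [i] \<preceq> \<delta> @ W" using W(2)[OF i(1)] by (rule ldvd_append_left)
    ultimately show ?thesis by (rule ldvd_trans)
  qed (rule ldvd_append_right)
  then show ?thesis using W(1) assms(2,3) by (intro has_common_multipleI[of "\<delta> @ W"]) auto
qed

definition braid_chain :: "(nat \<Rightarrow> nat) \<Rightarrow> nat \<Rightarrow> bool" where
  "braid_chain g r \<longleftrightarrow>
     (\<forall>i<r. [g i, g (Suc i), g i] \<approx> [g (Suc i), g i, g (Suc i)]) \<and>
     (\<forall>j\<le>r. \<forall>i. i + 2 \<le> j \<longrightarrow> [g i, g j] \<approx> [g j, g i])"

lemma braid_chain_Suc: "braid_chain g (Suc r) \<Longrightarrow> braid_chain g r"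
  by (simp add: braid_chain_def)

lemma braid_chain_shift:
  assumes "braid_chain g r" "i < r"
  shows "map g [0..<Suc r] @ [g i] \<approx> g (Suc i) # map g [0..<Suc r]"
proof -
  define A where "A = map g [0..<i]"
  define B where "B = map g [Suc (Suc i)..<Suc r]"
  have "[0..<Suc r] = [0..<i] @ [i..<Suc r]"
    using upt_add_eq_append[of 0 i "Suc r - i"] assms(2) by simp
  also have "[i..<Suc r] = i # Suc i # [Suc (Suc i)..<Suc r]"
    using assms(2) by (simp add: upt_conv_Cons del: upt_Suc)
  finally have up: "map g [0..<Suc r] = A @ [g i, g (Suc i)] @ B" by (simp add: A_def B_def)
  have commute_B: "B @ [g i] \<approx> [g i] @ B"
    using assms(1) by (intro commute_words) (auto simp: B_def braid_chain_def intro: peq.psym)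
  have commute_A: "A @ [g (Suc i)] \<approx> [g (Suc i)] @ A"
    using assms by (intro commute_words) (auto simp: A_def braid_chain_def)
  have braid: "[g i, g (Suc i), g i] \<approx> [g (Suc i), g i, g (Suc i)]"
    using assms by (simp add: braid_chain_def)
  have "A @ [g i, g (Suc i)] @ B @ [g i] \<approx> A @ [g i, g (Suc i)] @ [g i] @ B"
    by (intro peq_append_left commute_B)
  also have "\<dots> \<approx> (A @ [g (Suc i)]) @ [g i, g (Suc i)] @ B"
    using peq_context[OF braid, of A B] by simp
  also have "\<dots> \<approx> ([g (Suc i)] @ A) @ [g i, g (Suc i)] @ B"
    by (rule peq_append_right[OF commute_A])
  finally show ?thesis by (simp add: up del: upt_Suc)
qed

lemma has_common_multiple_chain: "braid_chain g r \<Longrightarrow> has_common_multiple (g ` {..r})"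
proof (induction r)
  case 0
  show ?case using has_common_multiple_singleton by simp
next
  case (Suc r)
  let ?\<delta> = "map g [0..<Suc (Suc r)]"
  show ?case
  proof (rule has_common_multiple_ribbon[of "g ` {..r}" _ ?\<delta>])
    show "has_common_multiple (g ` {..r})" using Suc braid_chain_Suc by blast
    fix j assume "j \<in> g ` {..Suc r}"
    then obtain i where i: "j = g i" "i \<le> Suc r" by auto
    show "[j] \<preceq> ?\<delta> \<or> (\<exists>x\<in>g ` {..r}. ?\<delta> @ [x] \<approx> j # ?\<delta>)"
    proof (cases i)
      case 0
      then have "?\<delta> = [j] @ map g [Suc 0..<Suc (Suc r)]"
        using i by (simp add: upt_conv_Cons del: upt_Suc)
      then show ?thesis using ldvd_append by metis
    next
      case (Suc i')
      then show ?thesis using braid_chain_shift[OF Suc.prems, of i'] i by auto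
    qed
  qed auto
qed

text \<open>Types \<open>B\<close> and \<open>D\<close>: a chain whose first vertex is joined to a core, which consists of the letters
  of \<open>c\<close>. The ribbon walks down the chain, through the core, and back up.\<close>

lemma core_ribbon_core:
  assumes "\<And>j. 0 < j \<Longrightarrow> j \<le> r \<Longrightarrow> [x, g j] \<approx> [g j, x] \<and> [y, g j] \<approx> [g j, y]"
    and twist: "(g 0 # c @ [g 0]) @ [x] \<approx> y # g 0 # c @ [g 0]"
  defines "up \<equiv> map g [0..<Suc r]"
  shows "(rev up @ c @ up) @ [x] \<approx> y # rev up @ c @ up"
proof -
  define p where "p = map g [Suc 0..<Suc r]"
  have up: "up = g 0 # p" by (simp add: up_def p_def upt_conv_Cons del: upt_Suc)
  have "p @ [x] \<approx> [x] @ p" "rev p @ [y] \<approx> [y] @ rev p"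
    using assms(1) by (intro commute_words; auto simp: p_def intro: peq.psym)+
  note commute = this
  have "(rev p @ g 0 # c @ [g 0]) @ p @ [x] \<approx> (rev p @ g 0 # c @ [g 0]) @ [x] @ p"
    by (rule peq_append_left) fact
  also have "\<dots> \<approx> (rev p @ [y]) @ (g 0 # c @ [g 0]) @ p"
    using peq_context[OF twist, of "rev p" p] by simp
  also have "\<dots> \<approx> ([y] @ rev p) @ (g 0 # c @ [g 0]) @ p"
    by (rule peq_append_right) fact
  finally show ?thesis by (simp add: up)
qed

lemma fork_twist:
  assumes "[a, b, a] \<approx> [b, a, b]" "[a, c, a] \<approx> [c, a, c]" "[b, c] \<approx> [c, b]"
  shows "(a # [b, c] @ [a]) @ [b] \<approx> c # a # [b, c] @ [a]"
    and "(a # [b, c] @ [a]) @ [c] \<approx> b # a # [b, c] @ [a]"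
proof -
  have "[a] @ [b, c] @ [a, b] \<approx> [a] @ [c, b] @ [a, b]" by (intro peq_context assms(3))
  also have "[a] @ [c, b] @ [a, b] \<approx> [a, c] @ [a, b, a] @ []"
    using peq_context[OF peq.psym[OF assms(1)], of "[a, c]" "[]"] by simp
  also have "\<dots> \<approx> [] @ [c, a, c] @ [b, a]" using peq_context[OF assms(2), of "[]" "[b, a]"] by simp
  also have "\<dots> \<approx> [c, a] @ [b, c] @ [a]"
    using peq_context[OF peq.psym[OF assms(3)], of "[c, a]" "[a]"] by simp
  finally show "(a # [b, c] @ [a]) @ [b] \<approx> c # a # [b, c] @ [a]" by simp
  have "[a, b] @ [c, a, c] @ [] \<approx> [a, b] @ [a, c, a] @ []"
    by (intro peq_context peq.psym[OF assms(2)])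
  also have "\<dots> \<approx> [] @ [b, a, b] @ [c, a]" using peq_context[OF assms(1), of "[]" "[c, a]"] by simp
  finally show "(a # [b, c] @ [a]) @ [c] \<approx> b # a # [b, c] @ [a]" by simp
qed

end

context coxeter_matrix
begin

lemma has_common_multiple_pair:
  assumes "i < n" "j < n" "i \<noteq> j"
  shows "has_common_multiple {i, j}"
proof (rule has_common_multipleI[of "alt i j (M i j)"])
  obtain m where m: "M i j = Suc m" using ge2[OF assms] by (cases "M i j") auto
  have "alt j i (M i j) \<approx> alt i j (M i j)" using peq_alt[OF assms] by (rule peq.psym)
  then have "[j] \<preceq> alt i j (M i j)" by (auto simp: m intro: ldvdI)
  moreover have "[i] \<preceq> alt i j (M i j)" using ldvd_append[of "[i]"] by (simp add: m)
  ultimately show "[x] \<preceq> alt i j (M i j)" if "x \<in> {i, j}" for x using that by auto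
qed (rule set_alt)

lemma core_ribbon_chain:
  assumes "braid_chain g r" "i < r"
    and "\<And>j x. 0 < j \<Longrightarrow> j \<le> r \<Longrightarrow> x \<in> set c \<Longrightarrow> [x, g j] \<approx> [g j, x]"
  defines "up \<equiv> map g [0..<Suc r]"
  shows "(rev up @ c @ up) @ [g i] \<approx> g i # rev up @ c @ up"
proof -
  have shift: "up @ [g i] \<approx> g (Suc i) # up" unfolding up_def by (rule braid_chain_shift[OF assms(1,2)])
  have "(rev up @ c) @ up @ [g i] \<approx> (rev up @ c) @ [g (Suc i)] @ up"
    using shift by (intro peq_append_left) simp
  also have "\<dots> \<approx> rev up @ ([g (Suc i)] @ c) @ up"
    using peq_context[of "c @ [g (Suc i)]" "[g (Suc i)] @ c" "rev up" up] assms(2,3)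
      commute_words[of c "[g (Suc i)]"] by simp
  also have "\<dots> \<approx> (g i # rev up) @ c @ up"
    using peq_append_right[OF peq.psym[OF peq_rev[OF shift]], of "c @ up"] by (auto intro: peq.psym)
  finally show ?thesis by simp
qed

lemma has_common_multiple_core_ribbon:
  assumes "braid_chain g r" "has_common_multiple (g ` {..<r} \<union> set c)"
    and commute: "\<And>j x. 0 < j \<Longrightarrow> j \<le> r \<Longrightarrow> x \<in> set c \<Longrightarrow> [x, g j] \<approx> [g j, x]"
    and twist: "\<And>y. y \<in> set c \<Longrightarrow> \<exists>x\<in>set c. (g 0 # c @ [g 0]) @ [x] \<approx> y # g 0 # c @ [g 0]"
  shows "has_common_multiple (g ` {..r} \<union> set c)"
proof (rule has_common_multiple_ribbon[OF assms(2)])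
  let ?up = "map g [0..<Suc r]"
  let ?\<delta> = "rev ?up @ c @ ?up"
  fix j assume "j \<in> g ` {..r} \<union> set c"
  then consider "j = g r" | i where "j = g i" "i < r" | "j \<in> set c" by force
  then show "[j] \<preceq> ?\<delta> \<or> (\<exists>i\<in>g ` {..<r} \<union> set c. ?\<delta> @ [i] \<approx> j # ?\<delta>)"
  proof cases
    case 1
    then show ?thesis using ldvd_append[of "[g r]"] by simp
  next
    case 2
    then show ?thesis using core_ribbon_chain[OF assms(1) 2(2) commute] by blast
  next
    case 3
    then obtain x where x: "x \<in> set c" "(g 0 # c @ [g 0]) @ [x] \<approx> j # g 0 # c @ [g 0]"
      using twist by blast
    have "?\<delta> @ [x] \<approx> j # ?\<delta>" using commute x 3 by (intro core_ribbon_core[of r x g j c]) blast+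
    then show ?thesis using x(1) by blast
  qed
qed (auto simp: less_Suc_eq_le)

lemma has_common_multiple_core_chain:
  assumes "braid_chain g r" "has_common_multiple (set c)"
    and commute: "\<And>j x. 0 < j \<Longrightarrow> j \<le> r \<Longrightarrow> x \<in> set c \<Longrightarrow> [x, g j] \<approx> [g j, x]"
    and twist: "\<And>y. y \<in> set c \<Longrightarrow> \<exists>x\<in>set c. (g 0 # c @ [g 0]) @ [x] \<approx> y # g 0 # c @ [g 0]"
  shows "has_common_multiple (g ` {..r} \<union> set c)"
  using assms(1,3)
proof (induction r)
  case 0
  then show ?case using has_common_multiple_core_ribbon[of g 0 c] assms(2) twist by simp
next
  case (Suc r)
  then have "has_common_multiple (g ` {..<Suc r} \<union> set c)"
    using braid_chain_Suc by (auto simp: lessThan_Suc_atMost)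
  then show ?case using has_common_multiple_core_ribbon[OF Suc.prems(1) _ Suc.prems(2) twist] by blast
qed

end

lemmas diagram_defs =
  diag_A_def diag_B_def diag_D_def diag_E_def diag_F4_def diag_H_def diag_I2_def

lemma diag_lab_chain_edges:
  "diag_lab (chain_edges a b) i j =
     (if j = Suc i \<and> a \<le> i \<and> i < b \<or> i = Suc j \<and> a \<le> j \<and> j < b then 3 else 2)"
proof (induction "b - a" arbitrary: a)
  case 0
  then show ?case by (auto simp: chain_edges_def)
next
  case (Suc d)
  have "chain_edges a b = (a, Suc a, 3) # chain_edges (Suc a) b"
    using Suc.hyps(2) by (auto simp: chain_edges_def upt_conv_Cons)
  moreover have "diag_lab (chain_edges (Suc a) b) i j =
     (if j = Suc i \<and> Suc a \<le> i \<and> i < b \<or> i = Suc j \<and> Suc a \<le> j \<and> j < b then 3 else 2)"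
    using Suc by (intro Suc.hyps(1)) auto
  ultimately show ?case using Suc.hyps(2) by auto
qed

lemma diag_lab_D:
  "diag_lab (diag_D (m + 3)) i j = (if i = m \<and> j = m + 2 \<or> i = m + 2 \<and> j = m then 3 else
     if (j = Suc i \<or> i = Suc j) \<and> i \<le> m + 1 \<and> j \<le> m + 1 then 3 else 2)"
  by (auto simp: diag_D_def diag_lab_chain_edges)

lemma diag_D_vertices: "{..<m + 3} = (-) m ` {..m} \<union> {m + 1, m + 2 :: nat}"
proof -
  have "x \<in> (-) m ` {..m}" if "x \<le> m" for x
    using that by (intro image_eqI[of _ _ "m - x"]) auto
  then have "(-) m ` {..m} = {..m}" by auto
  then show ?thesis by auto
qed

lemma diag_lab_E:
  "diag_lab (diag_E (m + 4)) i j = (if i = 2 \<and> j = m + 3 \<or> i = m + 3 \<and> j = 2 then 3 else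
     if (j = Suc i \<or> i = Suc j) \<and> i \<le> m + 2 \<and> j \<le> m + 2 then 3 else 2)"
  by (auto simp: diag_E_def diag_lab_chain_edges)

lemma diag_E_vertices: "{..<m + 4} = (\<lambda>i. i + 2) ` {..m} \<union> ({1, 0} \<union> {m + 3 :: nat})"
proof -
  have "(\<lambda>i. i + 2) ` {..m} = {2..m + 2}"
    using image_add_atLeastAtMost'[of 2 0 m] by (simp add: atMost_atLeast0)
  then show ?thesis by auto
qed

definition common_multiple_check :: "nat \<Rightarrow> (nat \<times> nat \<times> nat) list \<Rightarrow> nat list \<Rightarrow> bool" where
  "common_multiple_check k es W \<longleftrightarrow> list_all (\<lambda>a. a < k) W \<and>
     list_all (\<lambda>i. map_option fst (reversing (diag_lab es) (Suc (length W)) W [i]) = Some []) [0..<k]"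

text \<open>The words are \<open>c ^ (h div 2)\<close> for a bipartite Coxeter element \<open>c\<close> and the Coxeter number \<open>h\<close>.\<close>

lemma common_multiple_check_exceptional:
  "common_multiple_check 3 (diag_H 3) (concat (replicate 5 [0,2,1]))"
  "common_multiple_check 4 (diag_H 4) (concat (replicate 15 [0,2,1,3]))"
  "common_multiple_check 4 diag_F4 (concat (replicate 6 [0,2,1,3]))"
  "common_multiple_check 6 (diag_E 6) (concat (replicate 6 [0,2,4,1,3,5]))"
  "common_multiple_check 7 (diag_E 7) (concat (replicate 9 [0,2,4,1,3,5,6]))"
  "common_multiple_check 8 (diag_E 8) (concat (replicate 15 [0,2,4,6,1,3,5,7]))"
  by code_simp+

lemma (in artin_monoid) embedding_alt:
  assumes "coxeter_embedding g k L n M" "i < k" "j < k" "i \<noteq> j"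
  shows "alt (g i) (g j) (L i j) \<approx> alt (g j) (g i) (L i j)"
  using peq_alt[of "g i" "g j"] coxeter_embeddingD[OF assms(1)] assms(2-4) by simp

lemma (in artin_monoid) embedding_commute:
  assumes "coxeter_embedding g k L n M" "i < k" "j < k" "i \<noteq> j" "L i j = 2"
  shows "[g i, g j] \<approx> [g j, g i]"
  using embedding_alt[OF assms(1-4)] assms(5) by (simp add: numeral_2_eq_2)

lemma (in artin_monoid) embedding_braid:
  assumes "coxeter_embedding g k L n M" "i < k" "j < k" "i \<noteq> j" "L i j = 3"
  shows "[g i, g j, g i] \<approx> [g j, g i, g j]"
  using embedding_alt[OF assms(1-4)] assms(5) by (simp add: numeral_3_eq_3)

context coxeter_matrix
begin

lemma has_common_multiple_check:
  assumes "coxeter_embedding g k (diag_lab es) n M" "common_multiple_check k es W"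
  shows "has_common_multiple (g ` {..<k})"
proof (rule has_common_multipleI[of "map g W"])
  have W: "set W \<subseteq> {..<k}" using assms(2) by (auto simp: common_multiple_check_def list_all_iff)
  then show "set (map g W) \<subseteq> g ` {..<k}" by auto
  fix x assume "x \<in> g ` {..<k}"
  then obtain i where i: "x = g i" "i < k" by auto
  obtain t where "reversing (diag_lab es) (Suc (length W)) W [i] = Some ([], t)"
    using assms(2) i(2) by (fastforce simp: common_multiple_check_def list_all_iff)
  from right_lcm_peq[OF right_lcm_reversing[OF assms(1) this]] have "map g W \<approx> x # map g t"
    using W i by simp
  from peq.psym[OF this] show "[x] \<preceq> map g W" by (intro ldvdI) simp
qed

lemma braid_chain_embedding:
  assumes "coxeter_embedding g k L n M" "inj_on h {..r}" "\<And>i. i \<le> r \<Longrightarrow> h i < k"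
    and "\<And>i. i < r \<Longrightarrow> L (h i) (h (Suc i)) = 3"
    and "\<And>i j. i + 2 \<le> j \<Longrightarrow> j \<le> r \<Longrightarrow> L (h i) (h j) = 2"
  shows "braid_chain (g \<circ> h) r"
  using assms(2-5) embedding_commute[OF assms(1)] embedding_braid[OF assms(1)]
  by (simp add: braid_chain_def inj_on_eq_iff)

lemma has_common_multiple_A:
  assumes "coxeter_embedding g k (diag_lab (diag_A k)) n M" "k \<ge> 1"
  shows "has_common_multiple (g ` {..<k})"
proof -
  have "braid_chain (g \<circ> (\<lambda>i. i)) (k - 1)"
    by (rule braid_chain_embedding[OF assms(1)])
      (use assms(2) in \<open>auto simp: diag_A_def diag_lab_chain_edges\<close>)
  moreover have "{..k - 1} = {..<k}" using assms(2) by auto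
  ultimately show ?thesis using has_common_multiple_chain[of g "k - 1"] by (simp add: comp_def)
qed

lemma has_common_multiple_B:
  assumes "coxeter_embedding g k (diag_lab (diag_B k)) n M" "k \<ge> 2"
  shows "has_common_multiple (g ` {..<k})"
proof -
  obtain r where k: "k = Suc (Suc r)" using assms(2) by (metis add_2_eq_Suc le_Suc_ex)
  let ?h = "g \<circ> Suc"
  have "{..<k} = insert 0 (Suc ` {..r})"
    using lessThan_Suc_eq_insert_0[of "Suc r"] by (simp add: k lessThan_Suc_atMost)
  then have "g ` {..<k} = ?h ` {..r} \<union> set [g 0]" by (simp add: image_comp)
  moreover have "has_common_multiple (?h ` {..r} \<union> set [g 0])"
  proof (rule has_common_multiple_core_chain)
    show "braid_chain ?h r"
      by (rule braid_chain_embedding[OF assms(1)])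
        (auto simp: k diag_B_def diag_lab_chain_edges)
    show "[x, ?h j] \<approx> [?h j, x]" if "0 < j" "j \<le> r" "x \<in> set [g 0]" for j x
      using embedding_commute[OF assms(1), of 0 "Suc j"] that
      by (simp add: k diag_B_def diag_lab_chain_edges)
    show "\<exists>x\<in>set [g 0]. (?h 0 # [g 0] @ [?h 0]) @ [x] \<approx> y # ?h 0 # [g 0] @ [?h 0]"
      if "y \<in> set [g 0]" for y
      using embedding_alt[OF assms(1), of 1 0] that
      by (simp add: k diag_B_def diag_lab_chain_edges numeral_eq_Suc)
  qed (simp add: has_common_multiple_singleton)
  ultimately show ?thesis by simp
qed

lemma has_common_multiple_D:
  assumes "coxeter_embedding g k (diag_lab (diag_D k)) n M" "k \<ge> 4"
  shows "has_common_multiple (g ` {..<k})"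
proof -
  obtain m where k: "k = m + 3" using assms(2) by (intro that[of "k - 3"]) simp
  let ?h = "\<lambda>i. m - i"
  let ?b = "m + 1" and ?c = "m + 2"
  note rels = embedding_commute[OF assms(1)] embedding_braid[OF assms(1)]
  have "g ` {..<k} = (g \<circ> ?h) ` {..m} \<union> set [g ?b, g ?c]"
    unfolding k diag_D_vertices by (simp add: image_Un image_comp)
  moreover have "has_common_multiple ((g \<circ> ?h) ` {..m} \<union> set [g ?b, g ?c])"
  proof (rule has_common_multiple_core_chain)
    show "braid_chain (g \<circ> ?h) m"
      by (rule braid_chain_embedding[OF assms(1)]) (auto simp: diag_lab_D k inj_on_def)
    show "has_common_multiple (set [g ?b, g ?c])"
      using has_common_multiple_pair coxeter_embeddingD[OF assms(1)] by (simp add: k)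
    have "[g v, g (?h j)] \<approx> [g (?h j), g v]" if "0 < j" "j \<le> m" "v \<in> {?b, ?c}" for j v
      by (rule rels(1)) (use that in \<open>auto simp: diag_lab_D k\<close>)
    then show "[x, (g \<circ> ?h) j] \<approx> [(g \<circ> ?h) j, x]" if "0 < j" "j \<le> m" "x \<in> set [g ?b, g ?c]" for j x
      using that by auto
    have "[g m, g ?b, g m] \<approx> [g ?b, g m, g ?b]" "[g m, g ?c, g m] \<approx> [g ?c, g m, g ?c]"
      "[g ?b, g ?c] \<approx> [g ?c, g ?b]"
      using rels(1)[of ?b ?c] rels(2)[of m ?b] rels(2)[of m ?c] by (simp_all add: diag_lab_D k)
    from fork_twist[OF this] show "\<exists>x\<in>set [g ?b, g ?c].
        ((g \<circ> ?h) 0 # [g ?b, g ?c] @ [(g \<circ> ?h) 0]) @ [x] \<approx> y # (g \<circ> ?h) 0 # [g ?b, g ?c] @ [(g \<circ> ?h) 0]"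
      if "y \<in> set [g ?b, g ?c]" for y using that by auto
  qed
  ultimately show ?thesis by simp
qed

lemma has_common_multiple_std_diag:
  assumes "coxeter_embedding g k (diag_lab es) n M" "std_diag k es"
  shows "has_common_multiple (g ` {..<k})"
proof -
  have "g ` {..<2} = {g 0, g 1}" by (auto simp: less_2_cases_iff)
  then have "has_common_multiple (g ` {..<k})" if "k = 2"
    using has_common_multiple_pair[of "g 0" "g 1"] coxeter_embeddingD[OF assms(1)] that by simp
  then show ?thesis
    using assms has_common_multiple_A has_common_multiple_B has_common_multiple_D
      common_multiple_check_exceptional[THEN has_common_multiple_check[rotated]]
    unfolding std_diag_def by (elim disjE conjE exE insertE emptyE) simp_all
qed

end

section \<open>Spherical Coxeter matrices\<close>

lemma coxeter_embedding_inv_into: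
  assumes f: "bij_betw f C {..<k}" and "C \<subseteq> {..<n}"
    and "\<And>i j. i \<in> C \<Longrightarrow> j \<in> C \<Longrightarrow> i \<noteq> j \<Longrightarrow> M i j = L (f i) (f j)"
  shows "coxeter_embedding (inv_into C f) k L n M"
proof -
  let ?g = "inv_into C f"
  have g: "bij_betw ?g {..<k} C" by (rule bij_betw_inv_into[OF f])
  have "f (?g i) = i" "?g i \<in> C" if "i < k" for i
    using that bij_betw_inv_into_right[OF f] bij_betwE[OF g] by auto
  moreover have "?g ` {..<k} \<subseteq> {..<n}" using bij_betw_imp_surj_on[OF g] assms(2) by blast
  ultimately show ?thesis
    unfolding coxeter_embedding_def using bij_betw_imp_inj_on[OF g] assms(3)
    by (metis inj_on_eq_iff lessThan_iff)
qed

lemma spherical_components: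
  assumes "spherical n M"
  obtains Cs where "\<Union>Cs = {..<n}"
    and "\<forall>C\<in>Cs. \<forall>D\<in>Cs. C \<noteq> D \<longrightarrow> (\<forall>i\<in>C. \<forall>j\<in>D. i \<noteq> j \<and> M i j = 2)"
    and "\<forall>C\<in>Cs. \<exists>g k es. std_diag k es \<and> coxeter_embedding g k (diag_lab es) n M \<and> g ` {..<k} = C"
proof -
  obtain Cs where Cs: "\<Union>Cs = {..<n}" and disjoint: "\<forall>C\<in>Cs. \<forall>D\<in>Cs. C \<noteq> D \<longrightarrow> C \<inter> D = {}"
    and label_2: "\<forall>C\<in>Cs. \<forall>D\<in>Cs. C \<noteq> D \<longrightarrow> (\<forall>i\<in>C. \<forall>j\<in>D. M i j = 2)"
    and iso: "\<forall>C\<in>Cs. \<exists>f es. bij_betw f C {..<card C} \<and> std_diag (card C) es \<and>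
      (\<forall>i\<in>C. \<forall>j\<in>C. i \<noteq> j \<longrightarrow> M i j = diag_lab es (f i) (f j))"
    using assms(1) unfolding spherical_def by (elim exE conjE) (rule that)
  show thesis
  proof (rule that[OF Cs]; intro ballI impI)
    fix C D i j assume "C \<in> Cs" "D \<in> Cs" "C \<noteq> D" "i \<in> C" "j \<in> D"
    moreover from this have "C \<inter> D = {}" using disjoint by blast
    ultimately show "i \<noteq> j \<and> M i j = 2" using label_2 by auto
  next
    fix C assume C: "C \<in> Cs"
    then obtain f es where f: "bij_betw f C {..<card C}" and es: "std_diag (card C) es"
      and M: "\<And>i j. i \<in> C \<Longrightarrow> j \<in> C \<Longrightarrow> i \<noteq> j \<Longrightarrow> M i j = diag_lab es (f i) (f j)"
      using iso by meson
    have "C \<subseteq> {..<n}" using C Cs by blast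
    from coxeter_embedding_inv_into[where L = "diag_lab es", OF f this M]
    show "\<exists>g k es. std_diag k es \<and> coxeter_embedding g k (diag_lab es) n M \<and> g ` {..<k} = C"
      using es bij_betw_imp_surj_on[OF bij_betw_inv_into[OF f]] by blast
  qed
qed

lemma spherical_induct [consumes 1, case_names empty connected union]:
  assumes "spherical n M" and "P {}"
    and connected: "\<And>g k es. std_diag k es \<Longrightarrow> coxeter_embedding g k (diag_lab es) n M \<Longrightarrow> P (g ` {..<k})"
    and union: "\<And>S T. S \<union> T \<subseteq> {..<n} \<Longrightarrow> (\<And>i j. i \<in> S \<Longrightarrow> j \<in> T \<Longrightarrow> i \<noteq> j \<and> M i j = 2 \<and> M j i = 2) \<Longrightarrow>
      P S \<Longrightarrow> P T \<Longrightarrow> P (S \<union> T)"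
  shows "P {..<n}"
proof -
  from assms(1) obtain Cs where Cs: "\<Union>Cs = {..<n}"
    and label_2: "\<forall>C\<in>Cs. \<forall>D\<in>Cs. C \<noteq> D \<longrightarrow> (\<forall>i\<in>C. \<forall>j\<in>D. i \<noteq> j \<and> M i j = 2)"
    and components: "\<forall>C\<in>Cs. \<exists>g k es. std_diag k es \<and> coxeter_embedding g k (diag_lab es) n M \<and> g ` {..<k} = C"
    by (rule spherical_components)
  have "finite Cs" using Cs by (intro finite_UnionD) simp
  have "P (\<Union>Ds)" if "Ds \<subseteq> Cs" for Ds
    using finite_subset[OF that \<open>finite Cs\<close>] that
  proof (induction rule: finite_induct)
    case empty
    show ?case using assms(2) by simp
  next
    case (insert C Ds)
    have "P (C \<union> \<Union>Ds)"
    proof (rule union)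
      show "C \<union> \<Union>Ds \<subseteq> {..<n}" using Cs insert.prems by blast
      have "C \<in> Cs" using insert.prems by simp
      then obtain g k es where "std_diag k es" "coxeter_embedding g k (diag_lab es) n M"
        and C: "g ` {..<k} = C" using components by meson
      from connected[OF this(1,2)] show "P C" by (simp add: C)
      show "P (\<Union>Ds)" using insert by simp
      fix i j assume ij: "i \<in> C" "j \<in> \<Union>Ds"
      then obtain D where "D \<in> Ds" "j \<in> D" by blast
      then have "C \<in> Cs" "D \<in> Cs" "C \<noteq> D" "j \<in> D" using insert.hyps(2) insert.prems by auto
      then show "i \<noteq> j \<and> M i j = 2 \<and> M j i = 2"
        using label_2[rule_format, of C D i j] label_2[rule_format, of D C j i] ij(1) by blast
    qed
    then show ?case by simp
  qed
  from this[OF order.refl] show ?thesis by (simp add: Cs)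
qed

lemma diag_lab_sym: "diag_lab es i j = diag_lab es j i"
  by (induction es) auto

lemma diag_lab_ge2: "(\<And>a b m. (a, b, m) \<in> set es \<Longrightarrow> m \<ge> 2) \<Longrightarrow> diag_lab es i j \<ge> 2"
  by (induction es) (simp, fastforce)

lemma diag_lab_std_ge2: "std_diag k es \<Longrightarrow> diag_lab es i j \<ge> 2"
  by (rule diag_lab_ge2)
    (auto simp: std_diag_def diagram_defs chain_edges_def)

lemma coxeter_matrix_spherical:
  assumes "spherical n M"
  shows "coxeter_matrix n M"
proof -
  from assms have "\<forall>i\<in>{..<n}. \<forall>j\<in>{..<n}. i \<noteq> j \<longrightarrow> M i j = M j i \<and> M i j \<ge> 2"
  proof (induction rule: spherical_induct)
    case (connected g k es)
    then show ?case
      by (auto simp: coxeter_embeddingD[OF connected(2)] intro: diag_lab_sym diag_lab_std_ge2)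
  next
    case (union S T)
    then show ?case by (metis Un_iff order.refl)
  qed simp
  then show ?thesis by unfold_locales auto
qed

lemma spherical_tripleI:
  assumes "x \<in> {2, 3, 4, 5}" "y \<in> {2, 3, 4, 5}" "z \<in> {2, 3, 4, 5}" "x = 2 \<or> y = 2 \<or> z = 2"
    and "x \<le> 3 \<or> y \<le> 3" "x \<le> 3 \<or> z \<le> 3" "y \<le> 3 \<or> z \<le> 3"
  shows "spherical_triple x y z"
proof -
  have with_2: "spherical_triple 2 a b \<and> spherical_triple a 2 b \<and> spherical_triple a b 2"
    if "a \<in> {2, 3, 4, 5}" "b \<in> {2, 3, 4, 5}" "a \<le> 3 \<or> b \<le> 3" for a b
    using that
    by (elim insertE emptyE) (simp_all add: spherical_triple_def connected_rank3_labels_def)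
  show ?thesis
    using with_2[OF assms(1,2,5)] with_2[OF assms(1,3,6)] with_2[OF assms(2,3,7)] assms(4) by blast
qed

text \<open>By \<open>parent\<close> the diagram is a forest: the largest vertex of a triangle would have two smaller
  neighbours.\<close>

lemma spherical_triple_forest:
  fixes L :: "nat \<Rightarrow> nat \<Rightarrow> nat"
  assumes sym: "\<And>i j. L i j = L j i" and range: "\<And>i j. L i j \<in> {2, 3, 4, 5}"
    and parent: "\<And>i j v. i < v \<Longrightarrow> j < v \<Longrightarrow> L i v \<noteq> 2 \<Longrightarrow> L j v \<noteq> 2 \<Longrightarrow> i = j"
    and heavy: "\<And>i j i' j'. L i j > 3 \<Longrightarrow> L i' j' > 3 \<Longrightarrow> {i, j} = {i', j'}"
    and "distinct [i, j, l]"
  shows "spherical_triple (L i j) (L i l) (L j l)"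
proof (rule spherical_tripleI)
  have distinct: "i \<noteq> j" "i \<noteq> l" "j \<noteq> l" using assms(5) by auto
  then consider "i < l" "j < l" | "i < j" "l < j" | "j < i" "l < i" by linarith
  then show "L i j = 2 \<or> L i l = 2 \<or> L j l = 2"
    by cases (metis parent sym distinct)+
  show "L i j \<le> 3 \<or> L i l \<le> 3" "L i j \<le> 3 \<or> L j l \<le> 3" "L i l \<le> 3 \<or> L j l \<le> 3"
    using heavy[of i j i l] heavy[of i j j l] heavy[of i l j l] distinct
    by (auto simp: doubleton_eq_iff simp flip: not_less)
qed (rule range)+

lemma spherical_triple_std_diag:
  assumes "std_diag k es" "i < k" "j < k" "l < k" "distinct [i, j, l]"
  shows "spherical_triple (diag_lab es i j) (diag_lab es i l) (diag_lab es j l)"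
proof -
  have "k \<noteq> 2" using assms(2-5) by auto
  with assms(1) consider "es = diag_A k" | "es = diag_B k" | "k \<ge> 4" "es = diag_D k"
    | "k \<ge> 6" "es = diag_E k" | "es = diag_F4" | "es = diag_H k"
    unfolding std_diag_def by (elim disjE conjE exE) auto
  note diagram_cases = this
  show ?thesis
  proof (rule spherical_triple_forest[OF diag_lab_sym _ _ _ assms(5)])
    show "diag_lab es u v \<in> {2, 3, 4, 5}" for u v
      by (rule diagram_cases) (simp_all add: diagram_defs diag_lab_chain_edges)
    show "u = v" if "u < w" "v < w" "diag_lab es u w \<noteq> 2" "diag_lab es v w \<noteq> 2" for u v w
      by (rule diagram_cases)
        (use that in \<open>auto simp: diagram_defs diag_lab_chain_edges split: if_splits\<close>)
    show "{u, v} = {u', v'}" if "diag_lab es u v > 3" "diag_lab es u' v' > 3" for u v u' v'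
      by (rule diagram_cases)
        (use that in \<open>auto simp: diagram_defs diag_lab_chain_edges split: if_splits\<close>)
  qed
qed

lemma spherical_triples_spherical:
  assumes "spherical n M"
  shows "spherical_triples n M"
proof -
  from assms have "\<forall>a\<in>{..<n}. \<forall>b\<in>{..<n}. \<forall>c\<in>{..<n}. distinct [a, b, c] \<longrightarrow>
      spherical_triple (M a b) (M a c) (M b c)"
  proof (induction rule: spherical_induct)
    case (connected g k es)
    then show ?case
      by (auto simp: coxeter_embeddingD[OF connected(2)] intro: spherical_triple_std_diag)
  next
    case (union S T)
    show ?case
    proof (intro ballI impI)
      fix a b c assume "a \<in> S \<union> T" "b \<in> S \<union> T" "c \<in> S \<union> T" "distinct [a, b, c]"
      then show "spherical_triple (M a b) (M a c) (M b c)"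
        using union by (elim UnE) (auto simp: spherical_triple_def)
    qed
  qed simp
  then show ?thesis
    using coxeter_matrix_spherical[OF assms] by (simp add: spherical_triples_def spherical_triples_axioms_def)
qed

lemma has_common_multiple_spherical:
  assumes "spherical n M"
  shows "artin_monoid.has_common_multiple n M {..<n}"
proof -
  interpret coxeter_matrix n M by (rule coxeter_matrix_spherical[OF assms])
  from assms show ?thesis
  proof (induction rule: spherical_induct)
    case empty
    show ?case by (rule has_common_multiple_empty)
  next
    case (connected g k es)
    then show ?case using has_common_multiple_std_diag by blast
  next
    case (union S T)
    then show ?case using commute_letters by (intro has_common_multiple_Un) blast+
  qed
qed

lemma garside_spherical:
  assumes "spherical n M"
  shows "pos_word n (garside n M)"
    and "j < n \<Longrightarrow> \<exists>j'<n. peq n M (garside n M @ [j]) (j' # garside n M)"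
proof -
  interpret spherical_triples n M by (rule spherical_triples_spherical[OF assms])
  obtain W where W: "common_multiple {..<n} W"
    using has_common_multiple_spherical[OF assms] by (auto simp: has_common_multiple_def)
  show "pos_word n (garside n M)"
    using is_garside_garside[OF W] by (simp add: is_garside_def common_left_mult_def)
  show "j < n \<Longrightarrow> \<exists>j'<n. garside n M @ [j] \<approx> j' # garside n M"
    using garside_quasi_central[OF W] by metis
qed

section \<open>Growth series of languages\<close>

definition growth_series_le :: "real \<Rightarrow> 'a list set \<Rightarrow> real \<Rightarrow> bool" where
  "growth_series_le t X B \<longleftrightarrow> (\<forall>F \<subseteq> X. finite F \<longrightarrow> (\<Sum>x\<in>F. t ^ length x) \<le> B)"

lemma growth_series_leI:
  "(\<And>F. F \<subseteq> X \<Longrightarrow> finite F \<Longrightarrow> (\<Sum>x\<in>F. t ^ length x) \<le> B) \<Longrightarrow> growth_series_le t X B"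
  by (simp add: growth_series_le_def)

lemma growth_series_leD:
  "growth_series_le t X B \<Longrightarrow> F \<subseteq> X \<Longrightarrow> finite F \<Longrightarrow> (\<Sum>x\<in>F. t ^ length x) \<le> B"
  by (simp add: growth_series_le_def)

lemma growth_series_le_nonneg: "growth_series_le t X B \<Longrightarrow> 0 \<le> B"
  using growth_series_leD[of t X B "{}"] by simp

lemma growth_series_le_mono: "growth_series_le t Y B \<Longrightarrow> X \<subseteq> Y \<Longrightarrow> B \<le> B' \<Longrightarrow> growth_series_le t X B'"
  unfolding growth_series_le_def by (meson order.trans)

lemma growth_series_le_singleton:
  assumes "0 \<le> t"
  shows "growth_series_le t {w} (t ^ length w)"
  by (rule growth_series_leI) (use assms in \<open>auto simp: subset_singleton_iff\<close>)

lemma growth_series_le_Un: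
  assumes "growth_series_le t X B" "growth_series_le t Y C"
  shows "growth_series_le t (X \<union> Y) (B + C)"
proof (rule growth_series_leI)
  fix F assume F: "F \<subseteq> X \<union> Y" "finite F"
  have "(\<Sum>x\<in>F. t ^ length x) = (\<Sum>x\<in>F \<inter> X. t ^ length x) + (\<Sum>x\<in>F - X. t ^ length x)"
    using F(2) by (rule sum.Int_Diff)
  also have "\<dots> \<le> B + C"
    using F assms by (intro add_mono growth_series_leD[of t X] growth_series_leD[of t Y]) auto
  finally show "(\<Sum>x\<in>F. t ^ length x) \<le> B + C" .
qed

definition conc :: "'a list set \<Rightarrow> 'a list set \<Rightarrow> 'a list set" where
  "conc X Y = (\<lambda>(x, y). x @ y) ` (X \<times> Y)"

lemma concI: "x \<in> X \<Longrightarrow> y \<in> Y \<Longrightarrow> x @ y \<in> conc X Y"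
  by (auto simp: conc_def)

lemma concE:
  assumes "w \<in> conc X Y"
  obtains x y where "x \<in> X" "y \<in> Y" "w = x @ y"
  using assms by (auto simp: conc_def)

lemma conc_subset_lists:
  assumes "X \<subseteq> lists S" "Y \<subseteq> lists S"
  shows "conc X Y \<subseteq> lists S"
proof
  fix w assume "w \<in> conc X Y"
  then obtain x y where "x \<in> X" "y \<in> Y" "w = x @ y" by (rule concE)
  then show "w \<in> lists S" using assms subsetD[of X "lists S"] subsetD[of Y "lists S"] by simp
qed

lemma concat_subset_lists:
  assumes "X \<subseteq> lists S"
  shows "concat ` lists X \<subseteq> lists S"
proof (rule image_subsetI)
  fix xs assume "xs \<in> lists X"
  then show "concat xs \<in> lists S"
    by induction (use assms in \<open>auto simp del: in_lists_conv_set\<close>)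
qed

lemma growth_series_le_conc:
  assumes "growth_series_le t X B" "growth_series_le t Y C" "0 \<le> t"
  shows "growth_series_le t (conc X Y) (B * C)"
proof (rule growth_series_leI)
  fix F assume "F \<subseteq> conc X Y" "finite F"
  then obtain G where G: "G \<subseteq> X \<times> Y" "finite G" "F = (\<lambda>(x, y). x @ y) ` G"
    unfolding conc_def by (meson finite_subset_image)
  have "(\<Sum>w\<in>F. t ^ length w) \<le> (\<Sum>(x, y)\<in>G. t ^ length (x @ y))"
    using sum_image_le[OF G(2), of "\<lambda>w. t ^ length w" "\<lambda>(x, y). x @ y"] assms(3)
    by (simp add: G(3) comp_def split_def)
  also have "\<dots> \<le> (\<Sum>(x, y)\<in>fst ` G \<times> snd ` G. t ^ length (x @ y))"
    using G(2) assms(3) by (intro sum_mono2 subset_fst_snd) auto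
  also have "\<dots> = (\<Sum>x\<in>fst ` G. t ^ length x) * (\<Sum>y\<in>snd ` G. t ^ length y)"
    by (simp add: power_add sum_product sum.cartesian_product)
  also have "\<dots> \<le> B * C"
    using G(1,2) assms(3) growth_series_le_nonneg[OF assms(1)]
    by (intro mult_mono growth_series_leD[OF assms(1)] growth_series_leD[OF assms(2)] sum_nonneg) auto
  finally show "(\<Sum>w\<in>F. t ^ length w) \<le> B * C" .
qed

lemma growth_series_le_concat_lists:
  assumes "growth_series_le t X B" "0 \<le> t" "B < 1"
  shows "growth_series_le t (concat ` lists X) (1 / (1 - B))"
proof (rule growth_series_leI)
  have Nil: "growth_series_le t {[]} 1" using growth_series_le_singleton[OF assms(2), of "[]"] by simp
  have bounded: "growth_series_le t (concat ` {xs \<in> lists X. length xs \<le> m}) (1 / (1 - B))" for m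
  proof (induction m)
    case 0
    have "1 \<le> 1 / (1 - B)" using growth_series_le_nonneg[OF assms(1)] assms(3) by simp
    moreover have "concat ` {xs \<in> lists X. length xs \<le> 0} \<subseteq> {[]}" by auto
    ultimately show ?case using growth_series_le_mono[OF Nil] by blast
  next
    case (Suc m)
    let ?Z = "concat ` {xs \<in> lists X. length xs \<le> m}"
    have "concat xs \<in> {[]} \<union> conc X ?Z" if "xs \<in> lists X" "length xs \<le> Suc m" for xs
    proof (cases xs)
      case (Cons x ys)
      then have "x \<in> X" "concat ys \<in> ?Z" using that by simp_all
      then have "x @ concat ys \<in> conc X ?Z" by (rule concI)
      then show ?thesis by (simp add: Cons)
    qed simp
    then have "concat ` {xs \<in> lists X. length xs \<le> Suc m} \<subseteq> {[]} \<union> conc X ?Z"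
      by (intro image_subsetI) simp
    moreover have "growth_series_le t ({[]} \<union> conc X ?Z) (1 + B * (1 / (1 - B)))"
      by (intro growth_series_le_Un growth_series_le_conc Nil assms(1,2) Suc)
    moreover have "1 + B * (1 / (1 - B)) \<le> 1 / (1 - B)" using assms(3) by (simp add: field_simps)
    ultimately show ?case using growth_series_le_mono by blast
  qed
  fix F assume "F \<subseteq> concat ` lists X" "finite F"
  then obtain G where G: "G \<subseteq> lists X" "finite G" "F = concat ` G" by (meson finite_subset_image)
  obtain m where "\<forall>xs\<in>G. length xs \<le> m"
    using G(2) finite_nat_set_iff_bounded_le[of "length ` G"] by auto
  then show "(\<Sum>x\<in>F. t ^ length x) \<le> 1 / (1 - B)"
    using G by (intro growth_series_leD[OF bounded[of m]]) auto
qed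

lemma card_le_growth_series:
  assumes "growth_series_le t X B" "0 < t" "t \<le> 1"
  shows "finite {x \<in> X. length x \<le> k}" and "real (card {x \<in> X. length x \<le> k}) \<le> B * (1 / t) ^ k"
proof -
  have card_le: "real (card F) \<le> B * (1 / t) ^ k" if F: "F \<subseteq> {x \<in> X. length x \<le> k}" "finite F" for F
  proof -
    have "real (card F) * t ^ k = (\<Sum>x\<in>F. t ^ k)" by simp
    also have "\<dots> \<le> (\<Sum>x\<in>F. t ^ length x)"
      using F assms(2,3) by (intro sum_mono power_decreasing) auto
    also have "\<dots> \<le> B" using F by (intro growth_series_leD[OF assms(1)]) auto
    finally show ?thesis using assms(2) by (simp add: field_simps power_divide)
  qed
  then have "card F \<le> nat \<lfloor>B * (1 / t) ^ k\<rfloor>" if "F \<subseteq> {x \<in> X. length x \<le> k}" "finite F" for F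
    using that by (simp add: le_nat_floor)
  then show "finite {x \<in> X. length x \<le> k}" 
    using finite_if_finite_subsets_card_bdd by blast
  then show "real (card {x \<in> X. length x \<le> k}) \<le> B * (1 / t) ^ k" using card_le by blast
qed

lemma limsup_root_le:
  fixes f :: "nat \<Rightarrow> real"
  assumes "0 < C" "0 \<le> \<theta>" "\<And>k. f k \<le> C * \<theta> ^ k"
  shows "limsup (\<lambda>k. ereal (root k (f k))) \<le> ereal \<theta>"
proof -
  have "\<forall>\<^sub>F k in sequentially. ereal (root k (f k)) \<le> ereal (root k C * \<theta>)"
    using eventually_gt_at_top[of 0]
  proof eventually_elim
    case (elim k)
    then have "root k (f k) \<le> root k (C * \<theta> ^ k)" using assms(3) by simp
    then show ?case using elim assms(2) by (simp add: real_root_mult real_root_power_cancel)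
  qed
  then have "limsup (\<lambda>k. ereal (root k (f k))) \<le> limsup (\<lambda>k. ereal (root k C * \<theta>))"
    by (rule Limsup_mono)
  also have "(\<lambda>k. root k C * \<theta>) \<longlonglongrightarrow> 1 * \<theta>"
    by (intro tendsto_intros LIMSEQ_root_const assms(1))
  then have "limsup (\<lambda>k. ereal (root k C * \<theta>)) = ereal \<theta>"
    by (intro lim_imp_Limsup tendsto_ereal) simp_all
  finally show ?thesis .
qed

section \<open>Growth of Artin monoids\<close>

lemma eventually_at_right_nonneg: "0 \<le> \<tau> \<Longrightarrow> \<forall>\<^sub>F t in at_right \<tau>. 0 \<le> (t :: real)"
  using eventually_at_right_less[of \<tau>] by (rule eventually_mono) simp

context artin_monoid
begin

definition coset_reps :: "nat set \<Rightarrow> nat set \<Rightarrow> nat list set \<Rightarrow> bool" where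
  "coset_reps S Q X \<longleftrightarrow> Q \<subseteq> S \<and> X \<subseteq> lists S \<and> (\<forall>w\<in>lists S. \<exists>x\<in>X. \<exists>y\<in>lists Q. w \<approx> x @ y)"

lemma coset_repsE:
  assumes "coset_reps S Q X" "w \<in> lists S"
  obtains x y where "x \<in> X" "y \<in> lists Q" "w \<approx> x @ y"
  using assms unfolding coset_reps_def by blast

lemma coset_reps_refl: "coset_reps S S {[]}"
  by (auto simp: coset_reps_def)

lemma coset_reps_trans:
  assumes "coset_reps S Q X" "coset_reps Q R Y"
  shows "coset_reps S R (conc X Y)"
  unfolding coset_reps_def
proof (intro conjI ballI)
  show "R \<subseteq> S" using assms by (auto simp: coset_reps_def)
  show "conc X Y \<subseteq> lists S"
    using assms lists_mono[of Q S] unfolding coset_reps_def by (intro conc_subset_lists) blast+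
  fix w assume "w \<in> lists S"
  with assms(1) obtain x y where x: "x \<in> X" "y \<in> lists Q" "w \<approx> x @ y" by (rule coset_repsE)
  from assms(2) x(2) obtain x' y' where y: "x' \<in> Y" "y' \<in> lists R" "y \<approx> x' @ y'" by (rule coset_repsE)
  have "w \<approx> (x @ x') @ y'" using peq.ptrans[OF x(3) peq_append_left[OF y(3)]] by simp
  then show "\<exists>x\<in>conc X Y. \<exists>y\<in>lists R. w \<approx> x @ y" using concI[OF x(1) y(1)] y(2) by blast
qed

lemma commuting_letters_split:
  assumes "w \<in> lists (S \<union> T)"
    and commute: "\<And>i j. i \<in> S \<Longrightarrow> j \<in> T \<Longrightarrow> [i, j] \<approx> [j, i]"
  obtains u v where "u \<in> lists S" "v \<in> lists T" "w \<approx> u @ v"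
  using assms(1)
proof (induction w arbitrary: thesis)
  case Nil
  show ?case by (rule Nil[of "[]" "[]"]) auto
next
  case (Cons a w)
  obtain u v where uv: "u \<in> lists S" "v \<in> lists T" "w \<approx> u @ v"
    by (rule Cons.IH)
  then have w: "a # w \<approx> a # u @ v" by (intro peq_Cons)
  show thesis
  proof (cases "a \<in> S")
    case True
    then show thesis using Cons.prems[of "a # u" v] uv(1,2) w by simp
  next
    case False
    then have a: "a \<in> T" using Cons.hyps(1) by simp
    then have "[a] @ u \<approx> u @ [a]" using uv(1) commute by (intro commute_words) (auto intro: peq.psym)
    from peq_append_right[OF this, of v] have "a # u @ v \<approx> u @ a # v" by simp
    from peq.ptrans[OF w this] show thesis using Cons.prems[of u "a # v"] uv(1,2) a by simp
  qed
qed

lemma coset_reps_Un: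
  assumes "coset_reps S Q X" "coset_reps T R Y"
    and commute: "\<And>i j. i \<in> S \<Longrightarrow> j \<in> T \<Longrightarrow> [i, j] \<approx> [j, i]"
  shows "coset_reps (S \<union> T) (Q \<union> R) (conc X Y)"
  unfolding coset_reps_def
proof (intro conjI ballI)
  note subsets = assms(1,2)[unfolded coset_reps_def]
  show "Q \<union> R \<subseteq> S \<union> T" using subsets by blast
  show "conc X Y \<subseteq> lists (S \<union> T)"
    using subsets lists_mono[of S "S \<union> T"] lists_mono[of T "S \<union> T"] by (intro conc_subset_lists) blast+
  fix w assume "w \<in> lists (S \<union> T)"
  then obtain u v where uv: "u \<in> lists S" "v \<in> lists T" "w \<approx> u @ v"
    using commute by (rule commuting_letters_split)
  from assms(1) uv(1) obtain x y where x: "x \<in> X" "y \<in> lists Q" "u \<approx> x @ y" by (rule coset_repsE)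
  from assms(2) uv(2) obtain x' y' where y: "x' \<in> Y" "y' \<in> lists R" "v \<approx> x' @ y'" by (rule coset_repsE)
  have "y @ x' \<approx> x' @ y"
    using subsets x(2) y(1) commute by (intro commute_words) blast
  then have "x @ (y @ x') @ y' \<approx> x @ (x' @ y) @ y'" by (rule peq_context)
  then have "w \<approx> (x @ x') @ (y @ y')"
    using peq.ptrans[OF uv(3) peq_append[OF x(3) y(3)]] by (auto intro: peq.ptrans)
  moreover have "x @ x' \<in> conc X Y" using x(1) y(1) by (rule concI)
  ultimately show "\<exists>x\<in>conc X Y. \<exists>y\<in>lists (Q \<union> R). w \<approx> x @ y"
    using x(2) y(2) by (intro bexI[of _ "x @ x'"] bexI[of _ "y @ y'"]) auto
qed

lemma coset_reps_snoc:
  assumes "coset_reps S Q X" "y \<in> lists S" and commute: "\<And>q. q \<in> Q \<Longrightarrow> [q, c] \<approx> [c, q]"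
  obtains x q where "x \<in> X" "q \<in> lists S" "y @ [c] \<approx> (x @ [c]) @ q"
proof -
  from assms(1,2) obtain x q where x: "x \<in> X" "q \<in> lists Q" "y \<approx> x @ q" by (rule coset_repsE)
  have commute_q: "q @ [c] \<approx> [c] @ q" using x(2) commute by (intro commute_words) auto
  have "y @ [c] \<approx> x @ q @ [c]" using peq_append_right[OF x(3), of "[c]"] by simp
  also have "\<dots> \<approx> (x @ [c]) @ q" using peq_append_left[OF commute_q] by simp
  finally show thesis using that x(1,2) assms(1) by (auto simp: coset_reps_def)
qed

lemma coset_reps_insert:
  assumes "coset_reps S Q X" and commute: "\<And>q. q \<in> Q \<Longrightarrow> [q, c] \<approx> [c, q]"
  shows "coset_reps (insert c S) S (concat ` lists (conc X {[c]}))"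
  unfolding coset_reps_def
proof (intro conjI ballI)
  let ?Z = "concat ` lists (conc X {[c]})"
  have "conc X {[c]} \<subseteq> lists (insert c S)"
    using assms(1) lists_mono[of S "insert c S"] unfolding coset_reps_def
    by (intro conc_subset_lists) auto
  then show "?Z \<subseteq> lists (insert c S)" by (rule concat_subset_lists)
  fix w assume "w \<in> lists (insert c S)"
  then show "\<exists>z\<in>?Z. \<exists>y\<in>lists S. w \<approx> z @ y"
  proof (induction w rule: rev_induct)
    case Nil
    have "[] \<in> ?Z" by (intro image_eqI[of _ _ "[]"]) auto
    then show ?case by (intro bexI[of _ "[]"]) auto
  next
    case (snoc a w)
    then obtain zs y where zs: "zs \<in> lists (conc X {[c]})" and y: "y \<in> lists S"
      and w: "w @ [a] \<approx> concat zs @ y @ [a]"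
      using peq_append_right[of w _ "[a]"] by fastforce
    show ?case
    proof (cases "a = c")
      case False
      then have "y @ [a] \<in> lists S" using y snoc.prems by auto
      then show ?thesis using zs w by blast
    next
      case True
      from assms(1) y commute obtain x q where x: "x \<in> X" "q \<in> lists S" "y @ [c] \<approx> (x @ [c]) @ q"
        by (rule coset_reps_snoc)
      have "w @ [a] \<approx> concat (zs @ [x @ [c]]) @ q"
        using w peq_append_left[OF x(3), of "concat zs"] by (auto simp: True intro: peq.ptrans)
      moreover have "zs @ [x @ [c]] \<in> lists (conc X {[c]})" using zs concI[OF x(1)] by simp
      moreover note x(2)
      ultimately show ?thesis by blast
    qed
  qed
qed auto

text \<open>Passing to the limit \<open>t \<rightarrow> \<tau>\<close> from above keeps the estimates below at their critical values, while
  a finite bound for \<open>t\<close> slightly above \<open>\<tau>\<close> still gives a growth rate less than \<open>1 / \<tau>\<close>.\<close>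

definition coset_growth :: "real \<Rightarrow> nat set \<Rightarrow> nat set \<Rightarrow> real \<Rightarrow> bool" where
  "coset_growth \<tau> S Q b \<longleftrightarrow> (\<exists>B. (B \<longlongrightarrow> b) (at_right \<tau>) \<and>
     (\<forall>\<^sub>F t in at_right \<tau>. \<exists>X. coset_reps S Q X \<and> growth_series_le t X (B t)))"

lemma coset_growthE:
  assumes "coset_growth \<tau> S Q b"
  obtains B where "(B \<longlongrightarrow> b) (at_right \<tau>)"
    "\<forall>\<^sub>F t in at_right \<tau>. \<exists>X. coset_reps S Q X \<and> growth_series_le t X (B t)"
  using assms by (auto simp: coset_growth_def)

lemma coset_growth_refl:
  assumes "0 \<le> \<tau>"
  shows "coset_growth \<tau> S S 1"
  unfolding coset_growth_def
proof (intro exI[of _ "\<lambda>_. 1"] conjI tendsto_const)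
  show "\<forall>\<^sub>F t in at_right \<tau>. \<exists>X. coset_reps S S X \<and> growth_series_le t X 1"
    using eventually_at_right_nonneg[OF assms]
    by (rule eventually_mono)
      (use coset_reps_refl growth_series_le_singleton[of _ "[]"] in \<open>auto intro!: exI[of _ "{[]}"]\<close>)
qed

lemma coset_growth_mono:
  assumes "coset_growth \<tau> S Q b" "b \<le> c"
  shows "coset_growth \<tau> S Q c"
proof -
  obtain B where B: "(B \<longlongrightarrow> b) (at_right \<tau>)"
    "\<forall>\<^sub>F t in at_right \<tau>. \<exists>X. coset_reps S Q X \<and> growth_series_le t X (B t)"
    using assms(1) by (rule coset_growthE)
  have "((\<lambda>t. B t + (c - b)) \<longlongrightarrow> b + (c - b)) (at_right \<tau>)" by (intro tendsto_intros B(1))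
  moreover have "\<forall>\<^sub>F t in at_right \<tau>. \<exists>X. coset_reps S Q X \<and> growth_series_le t X (B t + (c - b))"
    using B(2) by (rule eventually_mono) (use assms(2) growth_series_le_mono in fastforce)
  ultimately show ?thesis unfolding coset_growth_def by auto
qed

lemma coset_growth_conc:
  assumes "coset_growth \<tau> S Q b" "coset_growth \<tau> S' Q' c" "0 \<le> \<tau>"
    and conc: "\<And>X Y. coset_reps S Q X \<Longrightarrow> coset_reps S' Q' Y \<Longrightarrow> coset_reps S'' Q'' (conc X Y)"
  shows "coset_growth \<tau> S'' Q'' (b * c)"
proof -
  obtain B where B: "(B \<longlongrightarrow> b) (at_right \<tau>)"
    "\<forall>\<^sub>F t in at_right \<tau>. \<exists>X. coset_reps S Q X \<and> growth_series_le t X (B t)"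
    using assms(1) by (rule coset_growthE)
  obtain C where C: "(C \<longlongrightarrow> c) (at_right \<tau>)"
    "\<forall>\<^sub>F t in at_right \<tau>. \<exists>X. coset_reps S' Q' X \<and> growth_series_le t X (C t)"
    using assms(2) by (rule coset_growthE)
  have "((\<lambda>t. B t * C t) \<longlongrightarrow> b * c) (at_right \<tau>)" by (intro tendsto_intros B(1) C(1))
  moreover have "\<forall>\<^sub>F t in at_right \<tau>. \<exists>X. coset_reps S'' Q'' X \<and> growth_series_le t X (B t * C t)"
    using B(2) C(2) eventually_at_right_nonneg[OF assms(3)]
    by eventually_elim (blast intro: conc growth_series_le_conc)
  ultimately show ?thesis unfolding coset_growth_def by blast
qed

lemma coset_growth_trans:
  "coset_growth \<tau> S Q b \<Longrightarrow> coset_growth \<tau> Q R c \<Longrightarrow> 0 \<le> \<tau> \<Longrightarrow> coset_growth \<tau> S R (b * c)"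
  using coset_growth_conc coset_reps_trans by metis

lemma coset_growth_Un:
  assumes "coset_growth \<tau> S Q b" "coset_growth \<tau> T R c" "0 \<le> \<tau>"
    and "\<And>i j. i \<in> S \<Longrightarrow> j \<in> T \<Longrightarrow> [i, j] \<approx> [j, i]"
  shows "coset_growth \<tau> (S \<union> T) (Q \<union> R) (b * c)"
  using assms(1-3) by (rule coset_growth_conc) (intro coset_reps_Un assms(4))

lemma coset_growth_insert:
  assumes "coset_growth \<tau> S Q b" "0 \<le> \<tau>" "\<tau> * b < 1"
    and commute: "\<And>q. q \<in> Q \<Longrightarrow> [q, c] \<approx> [c, q]"
  shows "coset_growth \<tau> (insert c S) S (1 / (1 - \<tau> * b))"
proof -
  obtain B where B: "(B \<longlongrightarrow> b) (at_right \<tau>)"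
    "\<forall>\<^sub>F t in at_right \<tau>. \<exists>X. coset_reps S Q X \<and> growth_series_le t X (B t)"
    using assms(1) by (rule coset_growthE)
  have lim: "((\<lambda>t. B t * t) \<longlongrightarrow> b * \<tau>) (at_right \<tau>)" by (intro tendsto_intros B(1))
  then have "((\<lambda>t. 1 / (1 - B t * t)) \<longlongrightarrow> 1 / (1 - b * \<tau>)) (at_right \<tau>)"
    using assms(3) by (intro tendsto_divide tendsto_diff tendsto_const) (auto simp: mult.commute)
  moreover have "\<forall>\<^sub>F t in at_right \<tau>. B t * t < 1"
    using order_tendstoD(2)[OF lim] assms(3) by (simp add: mult.commute)
  with B(2) eventually_at_right_nonneg[OF assms(2)]
  have "\<forall>\<^sub>F t in at_right \<tau>. \<exists>X. coset_reps (insert c S) S X \<and> growth_series_le t X (1 / (1 - B t * t))"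
  proof eventually_elim
    case (elim t)
    then obtain X where X: "coset_reps S Q X" "growth_series_le t X (B t)" by blast
    have "growth_series_le t (conc X {[c]}) (B t * t)"
      using growth_series_le_conc[OF X(2) growth_series_le_singleton[of t "[c]"]] elim by simp
    then show ?case
      using growth_series_le_concat_lists coset_reps_insert[OF X(1) commute] elim by blast
  qed
  ultimately show ?thesis unfolding coset_growth_def by (auto simp: mult.commute)
qed

text \<open>The bound 2 is the fixed point of \<open>b \<mapsto> 1 / (1 - b / 4)\<close>, so it propagates along a chain attached to a
  core \<open>T\<close> by its first vertex.\<close>

lemma coset_growth_chain:
  fixes g :: "nat \<Rightarrow> nat"
  assumes core: "coset_growth (1/4) T Q 2" and "\<And>q. q \<in> Q \<Longrightarrow> [q, g 0] \<approx> [g 0, q]"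
    and "\<And>i x. 0 < i \<Longrightarrow> i \<le> r \<Longrightarrow> x \<in> T \<Longrightarrow> [x, g i] \<approx> [g i, x]"
    and "\<And>i j. i + 2 \<le> j \<Longrightarrow> j \<le> r \<Longrightarrow> [g i, g j] \<approx> [g j, g i]"
  shows "coset_growth (1/4) (g ` {..r} \<union> T) (g ` {..<r} \<union> T) 2"
  using assms(3,4)
proof (induction r)
  case 0
  show ?case using coset_growth_insert[OF core, of "g 0"] assms(2) by simp
next
  case (Suc r)
  have "coset_growth (1/4) (g ` {..r} \<union> T) (g ` {..<r} \<union> T) 2" using Suc by simp
  moreover have "[q, g (Suc r)] \<approx> [g (Suc r), q]" if "q \<in> g ` {..<r} \<union> T" for q
    using that Suc.prems by auto
  ultimately show ?case
    using coset_growth_insert[of "1/4" "g ` {..r} \<union> T" "g ` {..<r} \<union> T" 2 "g (Suc r)"]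
    by (simp add: atMost_Suc lessThan_Suc_atMost)
qed

lemma coset_growth_chain_total:
  fixes g :: "nat \<Rightarrow> nat"
  assumes "coset_growth (1/4) T Q 2" "coset_growth (1/4) T {} b"
    and "\<And>q. q \<in> Q \<Longrightarrow> [q, g 0] \<approx> [g 0, q]"
    and "\<And>i x. 0 < i \<Longrightarrow> i \<le> r \<Longrightarrow> x \<in> T \<Longrightarrow> [x, g i] \<approx> [g i, x]"
    and "\<And>i j. i + 2 \<le> j \<Longrightarrow> j \<le> r \<Longrightarrow> [g i, g j] \<approx> [g j, g i]"
  shows "\<exists>b. coset_growth (1/4) (g ` {..r} \<union> T) {} b"
proof -
  have "\<exists>b. coset_growth (1/4) (g ` {..<m} \<union> T) {} b" if "m \<le> Suc r" for m
    using that
  proof (induction m)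
    case 0
    then show ?case using assms(2) by auto
  next
    case (Suc m)
    have "coset_growth (1/4) (g ` {..<Suc m} \<union> T) (g ` {..<m} \<union> T) 2"
      unfolding lessThan_Suc_atMost
      using assms(3-5) Suc.prems by (intro coset_growth_chain[OF assms(1)]) auto
    then show ?case using Suc coset_growth_trans by fastforce
  qed
  from this[of "Suc r"] show ?thesis by (simp add: lessThan_Suc_atMost)
qed

lemma coset_growth_letter: "coset_growth (1/4) {c} {} (4/3)"
  using coset_growth_insert[OF coset_growth_refl, of "1/4" "{}" c] by simp

lemma coset_growth_path:
  fixes g :: "nat \<Rightarrow> nat"
  assumes "\<And>i j. i + 2 \<le> j \<Longrightarrow> j \<le> r \<Longrightarrow> [g i, g j] \<approx> [g j, g i]"
  shows "\<exists>b. coset_growth (1/4) (g ` {..r}) {} b"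
proof -
  have "coset_growth (1/4) {} {} 1" by (rule coset_growth_refl) simp
  then have "coset_growth (1/4) {} {} 2" by (rule coset_growth_mono) simp
  from coset_growth_chain_total[OF this this, of g r] show ?thesis using assms by simp
qed

lemma coset_growth_path_embedding:
  assumes "coxeter_embedding g k L n M" "k \<ge> 1" "\<And>i j. i + 2 \<le> j \<Longrightarrow> j < k \<Longrightarrow> L i j = 2"
  shows "\<exists>b. coset_growth (1/4) (g ` {..<k}) {} b"
proof -
  have "\<exists>b. coset_growth (1/4) (g ` {..k - 1}) {} b"
    using assms(2,3) by (intro coset_growth_path embedding_commute[OF assms(1)]) auto
  moreover have "{..k - 1} = {..<k}" using assms(2) by auto
  ultimately show ?thesis by simp
qed

lemma coset_growth_D:
  assumes "coxeter_embedding g k (diag_lab (diag_D k)) n M" "k \<ge> 4"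
  shows "\<exists>b. coset_growth (1/4) (g ` {..<k}) {} b"
proof -
  obtain m where k: "k = m + 3" using assms(2) by (intro that[of "k - 3"]) simp
  note commute = embedding_commute[OF assms(1)[unfolded k], unfolded diag_lab_D]
  let ?T = "{g (m + 1)} \<union> {g (m + 2)}"
  have "[g (m + 1), g (m + 2)] \<approx> [g (m + 2), g (m + 1)]" by (rule commute) simp_all
  then have "coset_growth (1/4) ?T ({} \<union> {}) (4/3 * (4/3))"
    by (intro coset_growth_Un coset_growth_letter) auto
  then have core: "coset_growth (1/4) ?T {} 2" using coset_growth_mono by fastforce
  have "\<exists>b. coset_growth (1/4) ((\<lambda>i. g (m - i)) ` {..m} \<union> ?T) {} b"
  proof (rule coset_growth_chain_total[OF core core])
    have "[g v, g (m - i)] \<approx> [g (m - i), g v]" if "0 < i" "i \<le> m" "v \<in> {m + 1, m + 2}" for i v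
      by (rule commute) (use that in auto)
    then show "[x, g (m - i)] \<approx> [g (m - i), x]" if "0 < i" "i \<le> m" "x \<in> ?T" for i x
      using that by auto
    show "[g (m - i), g (m - j)] \<approx> [g (m - j), g (m - i)]" if "i + 2 \<le> j" "j \<le> m" for i j
      by (rule commute) (use that in auto)
  qed simp
  moreover have "g ` {..<k} = (\<lambda>i. g (m - i)) ` {..m} \<union> ?T"
    unfolding k diag_D_vertices by auto
  ultimately show ?thesis by simp
qed

lemma coset_growth_E:
  assumes "coxeter_embedding g k (diag_lab (diag_E k)) n M" "k \<ge> 4"
  shows "\<exists>b. coset_growth (1/4) (g ` {..<k}) {} b"
proof -
  obtain m where k: "k = m + 4" using assms(2) by (intro that[of "k - 4"]) simp
  note commute = embedding_commute[OF assms(1)[unfolded k], unfolded diag_lab_E]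
  let ?T = "{g 1, g 0} \<union> {g (m + 3)}"
  have arm: "coset_growth (1/4) {g 1, g 0} {g 0} (3/2)"
    using coset_growth_insert[OF coset_growth_letter[of "g 0"], of "g 1"] by simp
  have leaf: "[g v, g (m + 3)] \<approx> [g (m + 3), g v]" if "v \<in> {0, 1}" for v
    by (rule commute) (use that in auto)
  then have "coset_growth (1/4) ?T ({g 0} \<union> {}) (3/2 * (4/3))"
    by (intro coset_growth_Un arm coset_growth_letter) auto
  then have core: "coset_growth (1/4) ?T {g 0} 2" by simp
  have "\<exists>b. coset_growth (1/4) ((\<lambda>i. g (i + 2)) ` {..m} \<union> ?T) {} b"
  proof (rule coset_growth_chain_total[OF core coset_growth_trans[OF core coset_growth_letter]])
    show "[q, g (0 + 2)] \<approx> [g (0 + 2), q]" if "q \<in> {g 0}" for q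
      using that commute[of 0 "0 + 2"] by simp
    have "[g v, g (i + 2)] \<approx> [g (i + 2), g v]" if "0 < i" "i \<le> m" "v \<in> {0, 1, m + 3}" for i v
      by (rule commute) (use that in auto)
    then show "[x, g (i + 2)] \<approx> [g (i + 2), x]" if "0 < i" "i \<le> m" "x \<in> ?T" for i x
      using that by auto
    show "[g (i + 2), g (j + 2)] \<approx> [g (j + 2), g (i + 2)]" if "i + 2 \<le> j" "j \<le> m" for i j
      by (rule commute) (use that in auto)
  qed simp
  moreover have "g ` {..<k} = (\<lambda>i. g (i + 2)) ` {..m} \<union> ?T"
    unfolding k diag_E_vertices by (simp add: image_Un image_comp)
  ultimately show ?thesis by simp
qed

lemma coset_growth_std_diag:
  assumes "coxeter_embedding g k (diag_lab es) n M" "std_diag k es"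
  shows "\<exists>b. coset_growth (1/4) (g ` {..<k}) {} b"
proof -
  from assms(2) consider "k \<ge> 4" "es = diag_D k" | "k \<ge> 4" "es = diag_E k"
    | "k \<ge> 1" "\<And>i j. i + 2 \<le> j \<Longrightarrow> j < k \<Longrightarrow> diag_lab es i j = 2"
    unfolding std_diag_def
    by (elim disjE conjE exE) (auto simp: diag_A_def diag_B_def diag_F4_def diag_H_def diag_I2_def
        diag_lab_chain_edges)
  then show ?thesis
    using coset_growth_D coset_growth_E coset_growth_path_embedding assms(1) by cases blast+
qed

end

lemma coset_growth_spherical:
  assumes "spherical n M"
  shows "\<exists>b. artin_monoid.coset_growth n M (1/4) {..<n} {} b"
  using assms
proof (induction rule: spherical_induct)
  case empty
  show ?case using artin_monoid.coset_growth_refl[of "1/4"] by auto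
next
  case (connected g k es)
  then show ?case using artin_monoid.coset_growth_std_diag by blast
next
  case (union S T)
  then obtain b c where "artin_monoid.coset_growth n M (1/4) S {} b"
    "artin_monoid.coset_growth n M (1/4) T {} c" by blast
  moreover have "peq n M [i, j] [j, i]" if "i \<in> S" "j \<in> T" for i j
    using that union.hyps by (intro artin_monoid.commute_letters) auto
  ultimately have "artin_monoid.coset_growth n M (1/4) (S \<union> T) ({} \<union> {}) (b * c)"
    by (intro artin_monoid.coset_growth_Un) auto
  then show ?case by auto
qed

lemma (in artin_monoid) coset_growthD:
  assumes "coset_growth \<tau> S Q b" "\<tau> < u"
  obtains t X B where "\<tau> < t" "t < u" "coset_reps S Q X" "growth_series_le t X B"
proof -
  obtain B where "\<forall>\<^sub>F t in at_right \<tau>. \<exists>X. coset_reps S Q X \<and> growth_series_le t X (B t)"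
    using assms(1) by (rule coset_growthE)
  moreover have "\<forall>\<^sub>F t in at_right \<tau>. t \<in> {\<tau><..<u}"
    using assms(2) by (rule eventually_at_right_real)
  ultimately have "\<forall>\<^sub>F t in at_right \<tau>. t \<in> {\<tau><..<u} \<and> (\<exists>X. coset_reps S Q X \<and> growth_series_le t X (B t))"
    by eventually_elim blast
  from eventually_happens'[OF trivial_limit_at_right_real this] obtain t X
    where "\<tau> < t" "t < u" "coset_reps S Q X" "growth_series_le t X (B t)" by auto
  then show thesis by (rule that)
qed

section \<open>From the monoid to the group\<close>

abbreviation pos :: "nat list \<Rightarrow> (nat \<times> bool) list" where
  "pos w \<equiv> map (\<lambda>a. (a, True)) w"

abbreviation nablas :: "nat \<Rightarrow> (nat \<Rightarrow> nat \<Rightarrow> nat) \<Rightarrow> nat \<Rightarrow> (nat \<times> bool) list" where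
  "nablas n M r \<equiv> concat (replicate r (nabla_word n M))"

declare geq.grefl [simp, intro] and geq.gtrans [trans]

lemma geq_context:
  assumes "geq n M u v"
  shows "geq n M (x @ u @ y) (x @ v @ y)"
  using assms
proof induction
  case (gcancel i u b v)
  then show ?case using geq.gcancel[of i n M "x @ u" b "v @ y"] by simp
next
  case (grel i j u v)
  then show ?case using geq.grel[of i n j M "x @ u" "v @ y"] by simp
qed (blast intro: geq.gsym geq.gtrans)+

lemma geq_append_left: "geq n M u v \<Longrightarrow> geq n M (x @ u) (x @ v)"
  using geq_context[of n M u v x "[]"] by simp

lemma geq_append_right: "geq n M u v \<Longrightarrow> geq n M (u @ y) (v @ y)"
  using geq_context[of n M u v "[]" y] by simp

lemma geq_pos:
  assumes "peq n M u v"
  shows "geq n M (pos u) (pos v)"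
  using assms
proof induction
  case (prel i j u v)
  then show ?case using geq.grel[of i n j M "pos u" "pos v"] by simp
qed (blast intro: geq.gsym geq.gtrans)+

lemma gclass_eq: "geq n M u v \<Longrightarrow> gclass n M u = gclass n M v"
  unfolding gclass_def by (blast intro: geq.gsym geq.gtrans)

lemma geq_inverse:
  assumes "pos_word n w"
  shows "geq n M (map (\<lambda>a. (a, b)) w @ rev (map (\<lambda>a. (a, \<not> b)) w)) []"
  using assms
proof (induction w)
  case (Cons a w)
  have "geq n M ([(a, b)] @ (map (\<lambda>a. (a, b)) w @ rev (map (\<lambda>a. (a, \<not> b)) w)) @ [(a, \<not> b)])
      ([(a, b)] @ [] @ [(a, \<not> b)])"
    using Cons by (intro geq_context) (simp add: pos_word_def)
  also have "geq n M ([(a, b)] @ [] @ [(a, \<not> b)]) []"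
    using geq.gcancel[of a n M "[]" b "[]"] Cons.prems by (simp add: pos_word_def)
  finally show ?case by simp
qed simp

lemma geq_nabla:
  assumes "pos_word n (garside n M)"
  shows "geq n M (pos (garside n M) @ nabla_word n M) []"
    and "geq n M (nabla_word n M @ pos (garside n M)) []"
  using geq_inverse[OF assms, of M True] geq_inverse[of n "rev (garside n M)" M False] assms
  by (simp_all add: nabla_word_def pos_word_def rev_map)

lemma letter_nabla:
  assumes "spherical n M" "j < n"
  obtains j' where "j' < n" "geq n M ((j, True) # nabla_word n M) (nabla_word n M @ [(j', True)])"
proof -
  let ?D = "pos (garside n M)" and ?N = "nabla_word n M"
  obtain j' where j': "j' < n" "peq n M (garside n M @ [j]) (j' # garside n M)"
    using garside_spherical(2)[OF assms] by blast
  note inverse = geq_nabla[OF garside_spherical(1)[OF assms(1)]]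
  have "geq n M ((j, True) # ?N) ((?N @ ?D) @ (j, True) # ?N)"
    using geq_append_right[OF geq.gsym[OF inverse(2)], of "(j, True) # ?N"] by simp
  also have "geq n M \<dots> (?N @ pos (j' # garside n M) @ ?N)"
    using geq_context[OF geq_pos[OF j'(2)], of ?N ?N] by simp
  also have "geq n M \<dots> (?N @ [(j', True)])"
    using geq_append_left[OF inverse(1), of "?N @ [(j', True)]"] by simp
  finally show thesis using that j'(1) by blast
qed

lemma letter_nablas:
  assumes "spherical n M" "j < n"
  obtains j' where "j' < n" "geq n M ((j, True) # nablas n M r) (nablas n M r @ [(j', True)])"
  using assms(2)
proof (induction r arbitrary: j thesis)
  case 0
  then show ?case by auto
next
  case (Suc r)
  let ?N = "nabla_word n M"
  obtain i where i: "i < n" "geq n M ((j, True) # ?N) (?N @ [(i, True)])"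
    using letter_nabla[OF assms(1) Suc.prems(2)] .
  obtain j' where j': "j' < n" "geq n M ((i, True) # nablas n M r) (nablas n M r @ [(j', True)])"
    using Suc.IH[OF _ i(1)] .
  have "geq n M ((j, True) # ?N @ nablas n M r) (?N @ (i, True) # nablas n M r)"
    using geq_append_right[OF i(2), of "nablas n M r"] by simp
  also have "geq n M \<dots> (?N @ nablas n M r @ [(j', True)])"
    by (rule geq_append_left[OF j'(2)])
  finally show thesis using Suc.prems(1)[OF j'(1)] by simp
qed

lemma eval_word_nablas_pos:
  assumes "spherical n M" "valid_mword n w"
  obtains r p where "r + length p = length w" "pos_word n p"
    "geq n M (eval_word n M w) (nablas n M r @ pos p)"
  using assms(2)
proof (induction w arbitrary: thesis)
  case Nil
  show ?case by (rule Nil(1)[of 0 "[]"]) (simp_all add: eval_word_def pos_word_def)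
next
  case (Cons a w)
  have "valid_mword n w" using Cons.prems(2) by (simp add: valid_mword_def)
  then obtain r p where rp: "r + length p = length w" "pos_word n p"
    "geq n M (eval_word n M w) (nablas n M r @ pos p)"
    using Cons.IH by blast
  show thesis
  proof (cases a)
    case None
    have "geq n M (eval_word n M (a # w)) (nablas n M (Suc r) @ pos p)"
      using geq_append_left[OF rp(3), of "nabla_word n M"] by (simp add: None eval_word_def)
    then show thesis using Cons.prems(1)[of "Suc r" p] rp by simp
  next
    case (Some i)
    then have "i < n" using Cons.prems(2) by (auto simp: valid_mword_def)
    then obtain j where j: "j < n" "geq n M ((i, True) # nablas n M r) (nablas n M r @ [(j, True)])"
      by (rule letter_nablas[OF assms(1)])
    have "geq n M (eval_word n M (a # w)) ((i, True) # nablas n M r @ pos p)"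
      using geq_append_left[OF rp(3), of "[(i, True)]"] by (simp add: Some eval_word_def)
    also have "geq n M \<dots> (nablas n M r @ pos (j # p))"
      using geq_append_right[OF j(2), of "pos p"] by simp
    finally show thesis using Cons.prems(1)[of r "j # p"] rp j(1) by (simp add: pos_word_def)
  qed
qed

lemma sphere_count_le:
  assumes "spherical n M" "artin_monoid.coset_reps n M {..<n} {} X"
    and "finite {x \<in> X. length x \<le> k}"
  shows "sphere_count n M k \<le> card {x \<in> X. length x \<le> k}"
proof -
  interpret artin_monoid n M .
  let ?X = "{x \<in> X. length x \<le> k}"
  let ?class = "\<lambda>x. gclass n M (nablas n M (k - length x) @ pos x)"
  have "gclass n M (eval_word n M w) \<in> ?class ` ?X" if w: "valid_mword n w" "length w = k" for w
  proof -
    obtain r p where rp: "r + length p = length w" "pos_word n p"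
      "geq n M (eval_word n M w) (nablas n M r @ pos p)"
      by (rule eval_word_nablas_pos[OF assms(1) w(1)])
    have "p \<in> lists {..<n}" using rp(2) by (auto simp: pos_word_def)
    with assms(2) obtain x where x: "x \<in> X" "p \<approx> x" by (rule coset_repsE) auto
    have "geq n M (eval_word n M w) (nablas n M r @ pos x)"
      using rp(3) geq_append_left[OF geq_pos[OF x(2)]] by (rule geq.gtrans)
    moreover have "length x \<le> k" "r = k - length x" using rp(1) w(2) peq_length[OF x(2)] by auto
    ultimately show ?thesis using gclass_eq x(1) by blast
  qed
  then have "sphere_count n M k \<le> card (?class ` ?X)"
    unfolding sphere_count_def using assms(3) by (intro card_mono) auto
  also have "\<dots> \<le> card ?X" by (rule card_image_le[OF assms(3)])
  finally show ?thesis .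
qed

theorem theorem2:
  fixes n :: nat and M :: "nat \<Rightarrow> nat \<Rightarrow> nat"
  assumes "spherical n M"
  shows "limsup (\<lambda>k. ereal (root k (real (sphere_count n M k)))) < 4"
proof -
  interpret artin_monoid n M .
  obtain b where "coset_growth (1/4) {..<n} {} b" using coset_growth_spherical[OF assms] by blast
  then obtain t X B where t: "1/4 < t" "t < 1" and X: "coset_reps {..<n} {} X" "growth_series_le t X B"
    by (rule coset_growthD[where u = 1]) simp
  note card_X = card_le_growth_series[OF X(2)]
  have "real (sphere_count n M k) \<le> (B + 1) * (1 / t) ^ k" for k
  proof -
    have "real (sphere_count n M k) \<le> real (card {x \<in> X. length x \<le> k})"
      using sphere_count_le[OF assms X(1)] card_X(1) t by simp
    also have "\<dots> \<le> B * (1 / t) ^ k" using card_X(2) t by simp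
    also have "\<dots> \<le> (B + 1) * (1 / t) ^ k" using t by (intro mult_right_mono) auto
    finally show ?thesis .
  qed
  then have "limsup (\<lambda>k. ereal (root k (real (sphere_count n M k)))) \<le> ereal (1 / t)"
    using growth_series_le_nonneg[OF X(2)] t by (intro limsup_root_le) auto
  also have "\<dots> < 4" using t by (simp add: field_simps)
  finally show ?thesis .
qed

end
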